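(* Let $\mathcal{K}$ be a field, $\Gamma\leq\mathbb{R}$ an additive subgroup, $\Lambda=\Lambda^{\mathcal{K},\Gamma}$, and $\delta\geq 0$. If there is a chain level $\delta$-interleaving between the Floer-type complexes $(C_*,\partial_C,\ell_C)$ and $(D_*,\partial_D,\ell_D)$ over $\Lambda$, then there exists a $\delta$-quasiequivalence between $(C_*,\partial_C,\ell_C)$ and $(D_*,\partial_D,\ell_D)$.
   Context: **Novikov field.** $\Lambda=\Lambda^{\mathcal{K},\Gamma}$ is the field of formal sums $\sum_{g\in\Gamma}a_gT^g$ with $a_g\in\mathcal{K}$ such that for every $C\in\mathbb{R}$ only finitely many $g<C$ have $a_g\neq 0$, with power-series addition and multiplication. Its valuation is $\nu(\sum a_gT^g)=\min\{g\mid a_g\neq 0\}$, $\nu(0)=\infty$. **Orthogonalizable spaces.** A non-Archimedean normed vector space over $\Lambda$ is a pair $(C,\ell)$ with $C$ a $\Lambda$-vector space and $\ell\colon C\to\mathbb{R}\cup\{-\infty\}$ satisfying: $\ell(x)=-\infty$ iff $x=0$; $\ell(\lambda x)=\ell(x)-\nu(\lambda)$; $\ell(x+y)\leq\max\{\ell(x),\ell(y)\}$. A finite ordered collection $(w_1,\dots,w_r)$ in $C$ is orthogonal if $\ell(\sum_i\lambda_iw_i)=\max_i\ell(\lambda_iw_i)$ for all $\lambda_i\in\Lambda$. An orthogonalizable $\Lambda$-space is a finite-dimensional non-Archimedean normed vector space admitting an orthogonal basis. **Floer-type complex.** $(C_*,\partial_C,\ell_C)$ is a chain complex $C_*=\bigoplus_{k\in\mathbb{Z}}C_k$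 of $\Lambda$-vector spaces ($\partial_C C_k\subset C_{k-1}$) with a function $\ell_C$ such that each $(C_k,\ell_C|_{C_k})$ is orthogonalizable and $\ell_C(\partial_C x)\leq\ell_C(x)$ for $x\in C_k$. For $\lambda\in\mathbb{R}$, $C_*^\lambda$ is the subcomplex (of $\mathcal{K}$-vector spaces) with $C_k^\lambda=\{c\in C_k\mid\ell_C(c)\leq\lambda\}$. **Chain level $\delta$-interleaving.** A pair $(\Phi,\Psi)$ of $\Lambda$-linear degree-$0$ chain maps $\Phi\colon C_*\to D_*$, $\Psi\colon D_*\to C_*$ such that $\ell_D(\Phi c)\leq\ell_C(c)+\delta$ and $\ell_C(\Psi d)\leq\ell_D(d)+\delta$ for all homogeneous $c\in C_*$, $d\in D_*$, and for all $\lambda\in\mathbb{R}$ the compositions $\Psi\Phi\colon C_*^\lambda\to C_*^{\lambda+2\delta}$ and $\Phi\Psi\colon D_*^\lambda\to D_*^{\lambda+2\delta}$ induce the same maps on homology as the respective inclusions. **$\delta$-quasiequivalence.** A quadruple $(\Phi,\Psi,K_C,K_D)$ of $\Lambda$-linear maps where $\Phi\colon C_*\to D_*$, $\Psi\colon D_*\to C_*$ are degree-$0$ chain maps and $K_C\colon C_*\to C_{*+1}$, $K_D\colon D_*\to D_{*+1}$ satisfy $\Psi\Phi-I_{C_*}=\partial_CK_C+K_C\partial_C$ and $\Phi\Psi-I_{D_*}=\partial_DK_D+K_D\partial_D$, and for all homogeneous $c\in C_*$, $d\in D_*$: $\ell_D(\Phi c)\leq\ell_C(c)+\delta$, $\ell_C(\Psi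 d)\leq\ell_D(d)+\delta$, $\ell_C(K_Cc)\leq\ell_C(c)+2\delta$, $\ell_D(K_Dd)\leq\ell_D(d)+2\delta$. *)

theory Defs
  imports "HOL-Algebra.AbelCoset" "Jordan_Normal_Form.Missing_VectorSpace" "HOL-Library.Extended_Real"
begin

section \<open>The Novikov field\<close>

definition real_subgroup :: "real set \<Rightarrow> bool" where
  "real_subgroup \<Gamma> \<longleftrightarrow>
     0 \<in> \<Gamma> \<and> (\<forall>x\<in>\<Gamma>. \<forall>y\<in>\<Gamma>. x + y \<in> \<Gamma>) \<and> (\<forall>x\<in>\<Gamma>. - x \<in> \<Gamma>)"

text \<open>The formal sum \<open>\<Sum>g\<in>\<Gamma>. a\<^sub>g T\<^sup>g\<close> is represented by its coefficient function
  \<open>g \<mapsto> a\<^sub>g\<close>, extended by zero outside \<open>\<Gamma>\<close>.\<close>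

definition novikov_carrier :: "real set \<Rightarrow> (real \<Rightarrow> 'k::field) set" where
  "novikov_carrier \<Gamma> =
     {a. (\<forall>g. a g \<noteq> 0 \<longrightarrow> g \<in> \<Gamma>) \<and> (\<forall>c. finite {g. g < c \<and> a g \<noteq> 0})}"

text \<open>For elements of \<open>novikov_carrier \<Gamma>\<close> the index set of the following sum is finite.\<close>

definition novikov_mult :: "(real \<Rightarrow> 'k::field) \<Rightarrow> (real \<Rightarrow> 'k) \<Rightarrow> real \<Rightarrow> 'k" where
  "novikov_mult a b g = (\<Sum>h | a h \<noteq> 0 \<and> b (g - h) \<noteq> 0. a h * b (g - h))"

definition novikov :: "real set \<Rightarrow> (real \<Rightarrow> 'k::field) ring" where
  "novikov \<Gamma> =
     \<lparr>carrier = novikov_carrier \<Gamma>, mult = novikov_mult, one = (\<lambda>g. if g = 0 then 1 else 0),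
      zero = (\<lambda>g. 0), add = (\<lambda>a b g. a g + b g)\<rparr>"

definition valuation :: "(real \<Rightarrow> 'k::field) \<Rightarrow> ereal" where
  "valuation a = (if a = (\<lambda>g. 0) then \<infinity> else ereal (LEAST g. a g \<noteq> 0))"

subsection \<open>The field axioms\<close>

lemma novikovD:
  assumes "a \<in> novikov_carrier \<Gamma>"
  shows "a g \<noteq> 0 \<Longrightarrow> g \<in> \<Gamma>" "finite {g. g < c \<and> a g \<noteq> 0}"
  using assms by (auto simp: novikov_carrier_def)

lemma novikov_bounded_below:
  assumes "a \<in> novikov_carrier \<Gamma>"
  obtains m where "\<And>g. a g \<noteq> 0 \<Longrightarrow> m \<le> g"
proof -
  let ?S = "{g. g < 0 \<and> a g \<noteq> 0}"
  have fin: "finite (insert 0 ?S)" using novikovD(2)[OF assms] by simp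
  have "Min (insert 0 ?S) \<le> g" if "a g \<noteq> 0" for g
  proof (cases "g < 0")
    case True
    then show ?thesis using that fin by (intro Min_le) auto
  next
    case False
    have "Min (insert 0 ?S) \<le> 0" using fin by (intro Min_le) auto
    then show ?thesis using False by linarith
  qed
  then show thesis using that by blast
qed

lemma novikov_min:
  assumes "a \<in> novikov_carrier \<Gamma>" and "a \<noteq> (\<lambda>g. 0)"
  obtains m where "a m \<noteq> 0" and "\<And>g. a g \<noteq> 0 \<Longrightarrow> m \<le> g"
proof -
  obtain g0 where g0: "a g0 \<noteq> 0" using assms(2) by auto
  let ?S = "{g. g < g0 + 1 \<and> a g \<noteq> 0}"
  have fin: "finite ?S" using novikovD(2)[OF assms(1)] .
  have "g0 \<in> ?S" using g0 by simp
  then have ne: "?S \<noteq> {}" by blast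
  have "Min ?S \<in> ?S" using fin ne by (rule Min_in)
  moreover have "Min ?S \<le> g" if "a g \<noteq> 0" for g
  proof (cases "g < g0 + 1")
    case True
    then show ?thesis using that fin by (intro Min_le) auto
  next
    case False
    have "Min ?S \<le> g0" using fin g0 by (intro Min_le) auto
    then show ?thesis using False by linarith
  qed
  ultimately show thesis using that by blast
qed

lemma valuation_attained:
  assumes "a \<in> novikov_carrier \<Gamma>" and "a \<noteq> (\<lambda>g. 0)"
  obtains m where "valuation a = ereal m" and "a m \<noteq> 0" and "\<And>g. a g \<noteq> 0 \<Longrightarrow> m \<le> g"
proof -
  obtain m where m: "a m \<noteq> 0" "\<And>g. a g \<noteq> 0 \<Longrightarrow> m \<le> g" using novikov_min[OF assms] by blast
  have "(LEAST g. a g \<noteq> 0) = m" using m by (rule Least_equality)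
  then show thesis using that m assms(2) by (simp add: valuation_def)
qed

lemma novikov_mult_finite:
  assumes a: "a \<in> novikov_carrier \<Gamma>" and b: "b \<in> novikov_carrier \<Gamma>"
  shows "finite {h. a h \<noteq> 0 \<and> b (g - h) \<noteq> 0}"
proof -
  obtain m where m: "\<And>g. b g \<noteq> 0 \<Longrightarrow> m \<le> g" using novikov_bounded_below[OF b] by blast
  have "{h. a h \<noteq> 0 \<and> b (g - h) \<noteq> 0} \<subseteq> {h. h < g - m + 1 \<and> a h \<noteq> 0}"
    using m by fastforce
  then show ?thesis using novikovD(2)[OF a] by (rule finite_subset)
qed

lemma novikov_mult_eq_sum:
  assumes "finite S" and "\<And>h. a h \<noteq> 0 \<Longrightarrow> b (g - h) \<noteq> 0 \<Longrightarrow> h \<in> S"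
  shows "novikov_mult a b g = (\<Sum>h\<in>S. a h * b (g - h))"
  unfolding novikov_mult_def using assms by (intro sum.mono_neutral_left) auto

lemma novikov_mult_nonzero:
  assumes "novikov_mult a b g \<noteq> 0"
  shows "\<exists>h. a h \<noteq> 0 \<and> b (g - h) \<noteq> 0"
proof (rule ccontr)
  assume "\<not> ?thesis"
  then have "{h. a h \<noteq> 0 \<and> b (g - h) \<noteq> 0} = {}" by blast
  then have "novikov_mult a b g = 0" unfolding novikov_mult_def by (simp only: sum.empty)
  with assms show False by contradiction
qed

lemma novikov_mult_comm: "novikov_mult a b = novikov_mult b a"
proof
  fix g
  show "novikov_mult a b g = novikov_mult b a g"
    unfolding novikov_mult_def
    by (rule sum.reindex_bij_witness[of _ "\<lambda>h. g - h" "\<lambda>h. g - h"]) (auto simp: mult.commute)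
qed

lemma novikov_mult_closed:
  assumes \<Gamma>: "real_subgroup \<Gamma>" and a: "a \<in> novikov_carrier \<Gamma>" and b: "b \<in> novikov_carrier \<Gamma>"
  shows "novikov_mult a b \<in> novikov_carrier \<Gamma>"
proof -
  obtain m where m: "\<And>g. a g \<noteq> 0 \<Longrightarrow> m \<le> g" using novikov_bounded_below[OF a] by blast
  obtain n where n: "\<And>g. b g \<noteq> 0 \<Longrightarrow> n \<le> g" using novikov_bounded_below[OF b] by blast
  have ex: "\<exists>h. a h \<noteq> 0 \<and> b (g - h) \<noteq> 0" if "novikov_mult a b g \<noteq> 0" for g
    using that by (rule novikov_mult_nonzero)
  have "g \<in> \<Gamma>" if nz: "novikov_mult a b g \<noteq> 0" for g
  proof -
    obtain h where "a h \<noteq> 0" "b (g - h) \<noteq> 0" using ex[OF nz] by blast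
    then have "h \<in> \<Gamma>" "g - h \<in> \<Gamma>" using novikovD(1) a b by blast+
    then have "h + (g - h) \<in> \<Gamma>" using \<Gamma> unfolding real_subgroup_def by blast
    then show ?thesis by simp
  qed
  moreover have "finite {g. g < c \<and> novikov_mult a b g \<noteq> 0}" for c
  proof -
    have "{g. g < c \<and> novikov_mult a b g \<noteq> 0} \<subseteq>
      (\<lambda>(x, y). x + y) ` ({h. h < c - n \<and> a h \<noteq> 0} \<times> {h. h < c - m \<and> b h \<noteq> 0})"
    proof
      fix g assume "g \<in> {g. g < c \<and> novikov_mult a b g \<noteq> 0}"
      then have gc: "g < c" and "novikov_mult a b g \<noteq> 0" by auto
      then obtain h where h: "a h \<noteq> 0" "b (g - h) \<noteq> 0" using ex by blast
      have "(h, g - h) \<in> {h. h < c - n \<and> a h \<noteq> 0} \<times> {h. h < c - m \<and> b h \<noteq> 0}"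
        using h gc m[OF h(1)] n[OF h(2)] by auto
      then show "g \<in> (\<lambda>(x, y). x + y) ` ({h. h < c - n \<and> a h \<noteq> 0} \<times> {h. h < c - m \<and> b h \<noteq> 0})"
        by (rule rev_image_eqI) simp
    qed
    then show ?thesis
      using novikovD(2)[OF a] novikovD(2)[OF b] by (meson finite_SigmaI finite_imageI finite_subset)
  qed
  ultimately show ?thesis unfolding novikov_carrier_def by blast
qed

lemma novikov_mult_double:
  assumes "finite P" "finite Q"
    and P: "\<And>p q. a p \<noteq> 0 \<Longrightarrow> b q \<noteq> 0 \<Longrightarrow> p + q = g \<Longrightarrow> p \<in> P \<and> q \<in> Q"
  shows "novikov_mult a b g = (\<Sum>p\<in>P. \<Sum>q\<in>Q. if p + q = g then a p * b q else 0)"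
proof -
  have "novikov_mult a b g = (\<Sum>h\<in>P. a h * b (g - h))"
    using P by (intro novikov_mult_eq_sum assms) auto
  also have "\<dots> = (\<Sum>p\<in>P. \<Sum>q\<in>Q. if p + q = g then a p * b q else 0)"
  proof (rule sum.cong[OF refl])
    fix p
    have "(\<Sum>q\<in>Q. if p + q = g then a p * b q else 0) = (\<Sum>q\<in>Q. if q = g - p then a p * b q else 0)"
      by (intro sum.cong) auto
    also have "\<dots> = (if g - p \<in> Q then a p * b (g - p) else 0)"
      using assms(2) by simp
    also have "\<dots> = a p * b (g - p)" using P[of p "g - p"] by auto
    finally show "a p * b (g - p) = (\<Sum>q\<in>Q. if p + q = g then a p * b q else 0)" by simp
  qed
  finally show ?thesis .
qed

lemma novikov_mult_triple:
  assumes fin: "finite P" "finite Q" "finite R"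
    and P: "\<And>p q r. a p \<noteq> 0 \<Longrightarrow> b q \<noteq> 0 \<Longrightarrow> c r \<noteq> 0 \<Longrightarrow> p + q + r = g \<Longrightarrow> p \<in> P \<and> q \<in> Q \<and> r \<in> R"
  shows "novikov_mult (novikov_mult a b) c g =
    (\<Sum>p\<in>P. \<Sum>q\<in>Q. \<Sum>r\<in>R. if p + q + r = g then a p * b q * c r else 0)"
proof -
  define X where "X = (\<lambda>(x, y). x + y) ` (P \<times> Q)"
  have finX: "finite X" unfolding X_def using fin by auto
  have ex: "\<exists>h. a h \<noteq> 0 \<and> b (x - h) \<noteq> 0" if "novikov_mult a b x \<noteq> 0" for x
    using that by (rule novikov_mult_nonzero)
  have "novikov_mult (novikov_mult a b) c g =
    (\<Sum>x\<in>X. \<Sum>r\<in>R. if x + r = g then novikov_mult a b x * c r else 0)"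
  proof (rule novikov_mult_double[OF finX fin(3)])
    fix x r assume x: "novikov_mult a b x \<noteq> 0" and r: "c r \<noteq> 0" and g: "x + r = g"
    obtain h where h: "a h \<noteq> 0" "b (x - h) \<noteq> 0" using ex[OF x] by blast
    then have "h \<in> P \<and> x - h \<in> Q \<and> r \<in> R" using P[OF h r] g by simp
    then show "x \<in> X \<and> r \<in> R" unfolding X_def by (auto intro!: rev_image_eqI[of "(h, x - h)"])
  qed
  also have "\<dots> = (\<Sum>x\<in>X. \<Sum>r\<in>R. \<Sum>p\<in>P. \<Sum>q\<in>Q.
      if x + r = g \<and> p + q = x then a p * b q * c r else 0)"
  proof (intro sum.cong refl)
    fix x r assume "x \<in> X" "r \<in> R"
    show "(if x + r = g then novikov_mult a b x * c r else 0) =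
      (\<Sum>p\<in>P. \<Sum>q\<in>Q. if x + r = g \<and> p + q = x then a p * b q * c r else 0)"
    proof (cases "x + r = g \<and> c r \<noteq> 0")
      case True
      have "novikov_mult a b x = (\<Sum>p\<in>P. \<Sum>q\<in>Q. if p + q = x then a p * b q else 0)"
        using P True by (intro novikov_mult_double fin) blast
      then show ?thesis using True
        by (auto simp: sum_distrib_right intro!: sum.cong)
    next
      case False
      then have "(if x + r = g \<and> p + q = x then a p * b q * c r else 0) = 0" for p q by auto
      then show ?thesis using False by auto
    qed
  qed
  also have "\<dots> = (\<Sum>x\<in>X. \<Sum>p\<in>P. \<Sum>q\<in>Q. \<Sum>r\<in>R.
      if x + r = g \<and> p + q = x then a p * b q * c r else 0)"
    by (simp only: sum.swap[where A = R and B = P] sum.swap[where A = R and B = Q])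
  also have "\<dots> = (\<Sum>p\<in>P. \<Sum>q\<in>Q. \<Sum>r\<in>R. \<Sum>x\<in>X.
      if x + r = g \<and> p + q = x then a p * b q * c r else 0)"
    by (simp only: sum.swap[where A = X and B = P] sum.swap[where A = X and B = Q]
        sum.swap[where A = X and B = R])
  also have "\<dots> = (\<Sum>p\<in>P. \<Sum>q\<in>Q. \<Sum>r\<in>R. if p + q + r = g then a p * b q * c r else 0)"
  proof (intro sum.cong refl)
    fix p q r assume pq: "p \<in> P" "q \<in> Q"
    have X: "p + q \<in> X" unfolding X_def using pq by (auto intro!: rev_image_eqI[of "(p, q)"])
    have "(\<Sum>x\<in>X. if x + r = g \<and> p + q = x then a p * b q * c r else 0) =
      (\<Sum>x\<in>X. if x = p + q then (if p + q + r = g then a p * b q * c r else 0) else 0)"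
      by (intro sum.cong) auto
    also have "\<dots> = (if p + q + r = g then a p * b q * c r else 0)" using finX X by simp
    finally show "(\<Sum>x\<in>X. if x + r = g \<and> p + q = x then a p * b q * c r else 0) =
      (if p + q + r = g then a p * b q * c r else 0)" .
  qed
  finally show ?thesis .
qed

lemma novikov_mult_assoc:
  assumes a: "a \<in> novikov_carrier \<Gamma>" and b: "b \<in> novikov_carrier \<Gamma>" and c: "c \<in> novikov_carrier \<Gamma>"
  shows "novikov_mult (novikov_mult a b) c = novikov_mult a (novikov_mult b c)"
proof
  fix g
  obtain ma where ma: "\<And>g. a g \<noteq> 0 \<Longrightarrow> ma \<le> g" using novikov_bounded_below[OF a] by blast
  obtain mb where mb: "\<And>g. b g \<noteq> 0 \<Longrightarrow> mb \<le> g" using novikov_bounded_below[OF b] by blast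
  obtain mc where mc: "\<And>g. c g \<noteq> 0 \<Longrightarrow> mc \<le> g" using novikov_bounded_below[OF c] by blast
  define P where "P = {h. h < g - mb - mc + 1 \<and> a h \<noteq> 0}"
  define Q where "Q = {h. h < g - ma - mc + 1 \<and> b h \<noteq> 0}"
  define R where "R = {h. h < g - ma - mb + 1 \<and> c h \<noteq> 0}"
  have fin: "finite P" "finite Q" "finite R"
    unfolding P_def Q_def R_def using a b c novikovD(2) by blast+
  have PQR: "p \<in> P \<and> q \<in> Q \<and> r \<in> R"
    if "a p \<noteq> 0" "b q \<noteq> 0" "c r \<noteq> 0" "p + q + r = g" for p q r
    unfolding P_def Q_def R_def using that ma[OF that(1)] mb[OF that(2)] mc[OF that(3)] by auto
  have "novikov_mult (novikov_mult a b) c g =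
    (\<Sum>p\<in>P. \<Sum>q\<in>Q. \<Sum>r\<in>R. if p + q + r = g then a p * b q * c r else 0)"
    using PQR by (intro novikov_mult_triple fin) blast
  also have "\<dots> = (\<Sum>q\<in>Q. \<Sum>r\<in>R. \<Sum>p\<in>P. if p + q + r = g then a p * b q * c r else 0)"
    by (simp only: sum.swap[where A = P and B = Q] sum.swap[where A = P and B = R])
  also have "\<dots> = (\<Sum>q\<in>Q. \<Sum>r\<in>R. \<Sum>p\<in>P. if q + r + p = g then b q * c r * a p else 0)"
    by (intro sum.cong refl) (auto simp: algebra_simps)
  also have "\<dots> = novikov_mult (novikov_mult b c) a g"
    using PQR by (intro novikov_mult_triple[symmetric] fin) (metis add.commute add.left_commute)
  finally show "novikov_mult (novikov_mult a b) c g = novikov_mult a (novikov_mult b c) g"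
    by (simp add: novikov_mult_comm)
qed

lemma novikov_add_closed:
  assumes a: "a \<in> novikov_carrier \<Gamma>" and b: "b \<in> novikov_carrier \<Gamma>"
  shows "(\<lambda>g. a g + b g) \<in> novikov_carrier \<Gamma>"
proof -
  have "finite {g. g < c \<and> a g + b g \<noteq> 0}" for c
  proof (rule finite_subset)
    show "{g. g < c \<and> a g + b g \<noteq> 0} \<subseteq> {g. g < c \<and> a g \<noteq> 0} \<union> {g. g < c \<and> b g \<noteq> 0}" by auto
  qed (use novikovD(2) a b in blast)
  moreover have "g \<in> \<Gamma>" if "a g + b g \<noteq> 0" for g
    using that novikovD(1)[OF a, of g] novikovD(1)[OF b, of g] by (cases "a g = 0") auto
  ultimately show ?thesis unfolding novikov_carrier_def by blast
qed

lemma novikov_mult_add: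
  assumes a: "a \<in> novikov_carrier \<Gamma>" and b: "b \<in> novikov_carrier \<Gamma>" and c: "c \<in> novikov_carrier \<Gamma>"
  shows "novikov_mult (\<lambda>g. a g + b g) c = (\<lambda>g. novikov_mult a c g + novikov_mult b c g)"
proof
  fix g
  let ?S = "{h. a h \<noteq> 0 \<and> c (g - h) \<noteq> 0} \<union> {h. b h \<noteq> 0 \<and> c (g - h) \<noteq> 0}"
  have fin: "finite ?S" using novikov_mult_finite[OF a c] novikov_mult_finite[OF b c] by auto
  have "novikov_mult (\<lambda>g. a g + b g) c g = (\<Sum>h\<in>?S. (a h + b h) * c (g - h))"
    by (rule novikov_mult_eq_sum[OF fin]) auto
  also have "\<dots> = (\<Sum>h\<in>?S. a h * c (g - h)) + (\<Sum>h\<in>?S. b h * c (g - h))"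
    by (simp add: algebra_simps sum.distrib)
  also have "(\<Sum>h\<in>?S. a h * c (g - h)) = novikov_mult a c g"
    by (rule novikov_mult_eq_sum[OF fin, symmetric]) auto
  also have "(\<Sum>h\<in>?S. b h * c (g - h)) = novikov_mult b c g"
    by (rule novikov_mult_eq_sum[OF fin, symmetric]) auto
  finally show "novikov_mult (\<lambda>g. a g + b g) c g = novikov_mult a c g + novikov_mult b c g" .
qed

lemma novikov_mult_monom:
  "novikov_mult (\<lambda>g. if g = t then x else 0) a g = x * a (g - t)"
proof -
  have "novikov_mult (\<lambda>g. if g = t then x else 0) a g =
      (\<Sum>h\<in>{t}. (if h = t then x else 0) * a (g - h))"
    by (rule novikov_mult_eq_sum) (auto split: if_splits)
  then show ?thesis by simp
qed

lemma novikov_monom_closed: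
  assumes "t \<in> \<Gamma>"
  shows "(\<lambda>g. if g = t then x else 0) \<in> novikov_carrier \<Gamma>"
proof -
  have "finite {g. g < c \<and> (if g = t then x else 0) \<noteq> 0}" for c
    by (rule finite_subset[of _ "{t}"]) auto
  then show ?thesis unfolding novikov_carrier_def using assms by auto
qed

lemma novikov_cring:
  assumes \<Gamma>: "real_subgroup \<Gamma>"
  shows "cring (novikov \<Gamma> :: (real \<Rightarrow> 'k::field) ring)"
proof (rule cringI)
  have z: "(\<lambda>g. 0) \<in> novikov_carrier \<Gamma>" unfolding novikov_carrier_def by simp
  show "abelian_group (novikov \<Gamma> :: (real \<Rightarrow> 'k) ring)"
  proof (rule abelian_groupI)
    fix x :: "real \<Rightarrow> 'k" assume x: "x \<in> carrier (novikov \<Gamma>)"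
    then have "(\<lambda>g. - x g) \<in> carrier (novikov \<Gamma>)"
      unfolding novikov_def novikov_carrier_def by simp
    then show "\<exists>y\<in>carrier (novikov \<Gamma>). y \<oplus>\<^bsub>novikov \<Gamma>\<^esub> x = \<zero>\<^bsub>novikov \<Gamma>\<^esub>"
      by (rule rev_bexI) (simp add: novikov_def)
  qed (auto simp: novikov_def novikov_add_closed z algebra_simps)
  have 0: "0 \<in> \<Gamma>" using \<Gamma> unfolding real_subgroup_def by blast
  show "comm_monoid (novikov \<Gamma> :: (real \<Rightarrow> 'k) ring)"
  proof (rule comm_monoidI)
    fix x y :: "real \<Rightarrow> 'k"
    show "x \<otimes>\<^bsub>novikov \<Gamma>\<^esub> y = y \<otimes>\<^bsub>novikov \<Gamma>\<^esub> x"
      by (simp add: novikov_def novikov_mult_comm)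
  qed (auto simp: novikov_def novikov_mult_closed[OF \<Gamma>] novikov_mult_assoc novikov_mult_monom
        novikov_monom_closed[OF 0])
qed (auto simp: novikov_def novikov_mult_add)

text \<open>Geometric series: if \<open>n\<close> has positive valuation then \<open>1 - n\<close> is invertible.\<close>

lemma novikov_geometric:
  fixes n :: "real \<Rightarrow> 'k::field"
  assumes \<Gamma>: "real_subgroup \<Gamma>" and n: "n \<in> novikov_carrier \<Gamma>"
    and e: "e > 0" "\<And>g. n g \<noteq> 0 \<Longrightarrow> e \<le> g"
  obtains b where "b \<in> novikov_carrier \<Gamma>"
    and "\<And>g. b g = (if g = 0 then 1 else 0) + novikov_mult n b g"
proof -
  define F where "F b = (\<lambda>g. (if g = 0 then 1 else 0) + novikov_mult n b g)" for b :: "real \<Rightarrow> 'k"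
  define s where "s i = (F ^^ i) (\<lambda>g. 0)" for i
  have 0: "0 \<in> \<Gamma>" using \<Gamma> unfolding real_subgroup_def by blast
  have s_Suc: "s (Suc i) = F (s i)" for i unfolding s_def by simp
  have s_closed: "s i \<in> novikov_carrier \<Gamma>" for i
  proof (induction i)
    case 0
    show ?case unfolding s_def novikov_carrier_def by simp
  next
    case (Suc i)
    then show ?case unfolding s_Suc F_def
      by (intro novikov_add_closed novikov_monom_closed novikov_mult_closed \<Gamma> n 0)
  qed
  have F_cong: "F x g = F y g" if "\<And>h. h \<le> g - e \<Longrightarrow> x h = y h" for x y g
  proof -
    have eq: "x (g - h) = y (g - h)" if "n h \<noteq> 0" for h
      using e(2)[OF that] \<open>\<And>h. h \<le> g - e \<Longrightarrow> x h = y h\<close> by auto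
    have "novikov_mult n x g = novikov_mult n y g"
      unfolding novikov_mult_def using eq by (intro sum.cong) auto
    then show ?thesis unfolding F_def by simp
  qed
  have neg: "s i g = 0" if "g < 0" for i g
    using that
  proof (induction i arbitrary: g)
    case 0
    show ?case by (simp add: s_def)
  next
    case (Suc i)
    have "F (s i) g = F (\<lambda>g. 0) g" using Suc e(1) by (intro F_cong) auto
    also have "\<dots> = 0" using Suc.prems by (simp add: F_def novikov_mult_def)
    finally show ?case by (simp add: s_Suc)
  qed
  have step: "s (Suc i) g = s i g" if "g < real i * e" for i g
    using that
  proof (induction i arbitrary: g)
    case 0
    then show ?case using neg by simp
  next
    case (Suc i)
    have "F (s (Suc i)) g = F (s i) g"
      using Suc by (intro F_cong) (auto simp: algebra_simps)
    then show ?case by (simp add: s_Suc)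
  qed
  have stable: "s j g = s i g" if "i \<le> j" "g < real i * e" for i j g
    using that(1)
  proof (induction rule: dec_induct)
    case base
    show ?case ..
  next
    case (step j')
    have "real i * e \<le> real j' * e" using step(1) e(1) by (intro mult_right_mono) auto
    then show ?case using step(3) \<open>\<And>i g. g < real i * e \<Longrightarrow> s (Suc i) g = s i g\<close> that(2) by force
  qed
  have arch: "\<exists>i. g < real i * e" for g using reals_Archimedean3[OF e(1)] by blast
  define b where "b g = s (SOME i. g < real i * e) g" for g
  have b: "b g = s i g" if "g < real i * e" for i g
  proof -
    have "g < real (SOME i. g < real i * e) * e" using arch by (rule someI_ex)
    then show ?thesis unfolding b_def using stable that by (metis nat_le_linear)
  qed
  have "b \<in> novikov_carrier \<Gamma>"
  proof -
    have "g \<in> \<Gamma>" if "b g \<noteq> 0" for g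
      using that arch[of g] b novikovD(1)[OF s_closed] by metis
    moreover have "finite {g. g < c \<and> b g \<noteq> 0}" for c
    proof -
      obtain i where i: "c < real i * e" using arch by blast
      have "{g. g < c \<and> b g \<noteq> 0} = {g. g < c \<and> s i g \<noteq> 0}" using b[of _ i] i by auto
      then show ?thesis using novikovD(2)[OF s_closed] by simp
    qed
    ultimately show ?thesis unfolding novikov_carrier_def by blast
  qed
  moreover have "b g = (if g = 0 then 1 else 0) + novikov_mult n b g" for g
  proof -
    obtain i where i: "g < real i * e" using arch by blast
    have "b g = F (s i) g" using b[OF i] step[OF i] by (simp add: s_Suc)
    also have "\<dots> = F b g" using b[of _ i] i e(1) by (intro F_cong) auto
    finally show ?thesis by (simp add: F_def)
  qed
  ultimately show thesis using that by blast
qed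

lemma novikov_field:
  assumes \<Gamma>: "real_subgroup \<Gamma>"
  shows "field (novikov \<Gamma> :: (real \<Rightarrow> 'k::field) ring)"
proof (rule cring.cring_fieldI2[OF novikov_cring[OF \<Gamma>]])
  show "\<zero>\<^bsub>novikov \<Gamma>\<^esub> \<noteq> (\<one>\<^bsub>novikov \<Gamma>\<^esub> :: real \<Rightarrow> 'k)"
    by (simp add: novikov_def fun_eq_iff)
next
  fix a :: "real \<Rightarrow> 'k"
  assume "a \<in> carrier (novikov \<Gamma>)" and "a \<noteq> \<zero>\<^bsub>novikov \<Gamma>\<^esub>"
  then have a: "a \<in> novikov_carrier \<Gamma>" and "a \<noteq> (\<lambda>g. 0)" by (auto simp: novikov_def)
  then obtain m where m: "a m \<noteq> 0" "\<And>g. a g \<noteq> 0 \<Longrightarrow> m \<le> g" using novikov_min by blast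
  have 0: "0 \<in> \<Gamma>" and mm: "- m \<in> \<Gamma>"
    using \<Gamma> novikovD(1)[OF a m(1)] unfolding real_subgroup_def by blast+
  define t :: "real \<Rightarrow> 'k" where "t = (\<lambda>g. if g = - m then inverse (a m) else 0)"
  have t: "t \<in> novikov_carrier \<Gamma>" unfolding t_def using mm by (rule novikov_monom_closed)
  define n where "n = (\<lambda>g. (if g = 0 then 1 else 0) +
    novikov_mult (\<lambda>g. if g = 0 then - 1 else 0) (novikov_mult t a) g)"
  have n_eq: "n g = (if g = 0 then 1 else 0) - inverse (a m) * a (g + m)" for g
    by (simp add: n_def novikov_mult_monom t_def)
  have n: "n \<in> novikov_carrier \<Gamma>"
    unfolding n_def using 0 t a \<Gamma>
    by (intro novikov_add_closed novikov_mult_closed novikov_monom_closed)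
  have pos: "g > 0" if "n g \<noteq> 0" for g
  proof (rule ccontr)
    assume "\<not> g > 0"
    then consider "g = 0" | "g < 0" by linarith
    then show False
    proof cases
      case 1
      then show False using that m(1) by (simp add: n_eq)
    next
      case 2
      then have "a (g + m) = 0" using m(2)[of "g + m"] by linarith
      then show False using that 2 by (simp add: n_eq)
    qed
  qed
  obtain e where e: "e > 0" "\<And>g. n g \<noteq> 0 \<Longrightarrow> e \<le> g"
  proof (cases "n = (\<lambda>g. 0)")
    case True
    then show thesis using that[of 1] by simp
  next
    case False
    then obtain e where "n e \<noteq> 0" "\<And>g. n g \<noteq> 0 \<Longrightarrow> e \<le> g" using novikov_min[OF n] by blast
    then show thesis using that pos by blast
  qed
  obtain b where b: "b \<in> novikov_carrier \<Gamma>"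
    and b_eq: "\<And>g. b g = (if g = 0 then 1 else 0) + novikov_mult n b g"
    using novikov_geometric[OF \<Gamma> n e] by blast
  let ?one = "\<lambda>g. if g = 0 then 1 else (0::'k)"
  have ta: "novikov_mult t a = (\<lambda>g. ?one g + novikov_mult (\<lambda>g. if g = 0 then - 1 else 0) n g)"
    by (rule ext) (simp add: novikov_mult_monom n_def)
  have m1: "(\<lambda>g. if g = 0 then - 1 else (0::'k)) \<in> novikov_carrier \<Gamma>"
    and one: "?one \<in> novikov_carrier \<Gamma>" using 0 by (intro novikov_monom_closed; simp)+
  have "novikov_mult (novikov_mult t a) b = ?one"
  proof
    fix g
    have "novikov_mult (novikov_mult t a) b g =
        novikov_mult ?one b g + novikov_mult (novikov_mult (\<lambda>g. if g = 0 then - 1 else 0) n) b g"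
      unfolding ta
      by (subst novikov_mult_add[OF one novikov_mult_closed[OF \<Gamma> m1 n] b]) simp
    also have "\<dots> = b g - novikov_mult n b g"
      by (subst novikov_mult_assoc[OF m1 n b]) (simp add: novikov_mult_monom)
    also have "\<dots> = ?one g" using b_eq[of g] by simp
    finally show "novikov_mult (novikov_mult t a) b g = ?one g" .
  qed
  then have "novikov_mult a (novikov_mult t b) = ?one"
    by (metis a b t novikov_mult_assoc novikov_mult_comm)
  then show "\<exists>b\<in>carrier (novikov \<Gamma>). a \<otimes>\<^bsub>novikov \<Gamma>\<^esub> b = \<one>\<^bsub>novikov \<Gamma>\<^esub>"
    using novikov_mult_closed[OF \<Gamma> t b] by (auto simp: novikov_def)
qed

section \<open>Orthogonalizable spaces\<close>

text \<open>The conventions of \<^typ>\<open>ereal\<close> give \<open>lev (\<zero> \<odot> x) = lev x - \<infinity> = - \<infinity>\<close>, as intended.\<close>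

locale nonarch_normed_space = vectorspace "novikov \<Gamma>" V
  for \<Gamma> :: "real set" and V :: "(real \<Rightarrow> 'k::field, 'c) module" (structure) +
  fixes lev :: "'c \<Rightarrow> ereal"
  assumes level_not_PInf: "x \<in> carrier V \<Longrightarrow> lev x \<noteq> \<infinity>"
    and level_eq_MInf_iff: "x \<in> carrier V \<Longrightarrow> lev x = - \<infinity> \<longleftrightarrow> x = \<zero>\<^bsub>V\<^esub>"
    and level_smult:
      "a \<in> carrier (novikov \<Gamma>) \<Longrightarrow> x \<in> carrier V \<Longrightarrow> lev (a \<odot>\<^bsub>V\<^esub> x) = lev x - valuation a"
    and level_add:
      "x \<in> carrier V \<Longrightarrow> y \<in> carrier V \<Longrightarrow> lev (x \<oplus>\<^bsub>V\<^esub> y) \<le> max (lev x) (lev y)"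

text \<open>The supremum is the maximum over the finitely many indices; for the empty collection it
  is \<open>- \<infinity>\<close>, which is \<open>lev\<close> of the empty sum.\<close>

definition orthogonal_list ::
  "real set \<Rightarrow> (real \<Rightarrow> 'k::field, 'c) module \<Rightarrow> ('c \<Rightarrow> ereal) \<Rightarrow> 'c list \<Rightarrow> bool" where
  "orthogonal_list \<Gamma> V lev ws \<longleftrightarrow>
     set ws \<subseteq> carrier V \<and>
     (\<forall>a \<in> {..<length ws} \<rightarrow> carrier (novikov \<Gamma>).
        lev (\<Oplus>\<^bsub>V\<^esub>i\<in>{..<length ws}. a i \<odot>\<^bsub>V\<^esub> ws ! i) =
        (SUP i\<in>{..<length ws}. lev (a i \<odot>\<^bsub>V\<^esub> ws ! i)))"

definition orthogonalizable ::
  "real set \<Rightarrow> (real \<Rightarrow> 'k::field, 'c) module \<Rightarrow> ('c \<Rightarrow> ereal) \<Rightarrow> bool" where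
  "orthogonalizable \<Gamma> V lev \<longleftrightarrow>
     nonarch_normed_space \<Gamma> V lev \<and> vectorspace.fin_dim (novikov \<Gamma>) V \<and>
     (\<exists>ws. distinct ws \<and> vectorspace.basis (novikov \<Gamma>) V (set ws) \<and> orthogonal_list \<Gamma> V lev ws)"

section \<open>Floer-type complexes\<close>

text \<open>A graded space \<open>C\<^sub>* = \<Oplus>k. C\<^sub>k\<close> is given by the family of its homogeneous parts \<open>C\<^sub>k\<close>,
  and graded linear maps by families of linear maps between these.  The parts of a complex live
  in one type (for instance that of the direct sum), but are otherwise unrelated; the filtration
  level also takes the degree as an argument.\<close>

record ('k, 'c) filtered_complex =
  chains :: "int \<Rightarrow> (real \<Rightarrow> 'k, 'c) module"
  bdry :: "int \<Rightarrow> 'c \<Rightarrow> 'c"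
  level :: "int \<Rightarrow> 'c \<Rightarrow> ereal"

definition floer_type_complex :: "real set \<Rightarrow> ('k::field, 'c) filtered_complex \<Rightarrow> bool" where
  "floer_type_complex \<Gamma> C \<longleftrightarrow>
     (\<forall>k. orthogonalizable \<Gamma> (chains C k) (level C k)) \<and>
     (\<forall>k. bdry C k \<in> LinearCombinations.module_hom (novikov \<Gamma>) (chains C k) (chains C (k - 1))) \<and>
     (\<forall>k. \<forall>x\<in>carrier (chains C k). bdry C (k - 1) (bdry C k x) = \<zero>\<^bsub>chains C (k - 2)\<^esub>) \<and>
     (\<forall>k. \<forall>x\<in>carrier (chains C k). level C (k - 1) (bdry C k x) \<le> level C k x)"

subsection \<open>Filtered homology\<close>

definition sublevel :: "('k::field, 'c) filtered_complex \<Rightarrow> int \<Rightarrow> real \<Rightarrow> 'c set" where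
  "sublevel C k s = {c \<in> carrier (chains C k). level C k c \<le> ereal s}"

definition cycles :: "('k::field, 'c) filtered_complex \<Rightarrow> int \<Rightarrow> real \<Rightarrow> 'c set" where
  "cycles C k s = {c \<in> sublevel C k s. bdry C k c = \<zero>\<^bsub>chains C (k - 1)\<^esub>}"

definition boundaries :: "('k::field, 'c) filtered_complex \<Rightarrow> int \<Rightarrow> real \<Rightarrow> 'c set" where
  "boundaries C k s = bdry C (k + 1) ` sublevel C (k + 1) s"

text \<open>The \<open>k\<close>-th homology of the subcomplex \<open>C\<^sub>*\<^sup>s\<close>, as an abelian group; its scalar
  multiplication plays no role in comparing induced maps.\<close>

definition homology :: "('k::field, 'c) filtered_complex \<Rightarrow> int \<Rightarrow> real \<Rightarrow> 'c set monoid" where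
  "homology C k s = (chains C k)\<lparr>carrier := cycles C k s\<rparr> A_Mod boundaries C k s"

text \<open>The map into the \<open>k\<close>-th homology of \<open>D\<^sub>*\<^sup>t\<close> induced by a chain map with degree \<open>k\<close>
  component \<open>f\<close>: it sends the class \<open>X\<close> of a cycle \<open>x\<close> to the class of \<open>f x\<close>.  For such \<open>f\<close>
  all sets in the union are the same coset.\<close>

definition homology_map ::
  "('k::field, 'd) filtered_complex \<Rightarrow> int \<Rightarrow> real \<Rightarrow> ('c \<Rightarrow> 'd) \<Rightarrow> 'c set \<Rightarrow> 'd set" where
  "homology_map D k t f X = (\<Union>x\<in>X. boundaries D k t +>\<^bsub>chains D k\<^esub> f x)"

section \<open>Interleavings and quasiequivalences\<close>

definition chain_map ::
  "real set \<Rightarrow> ('k::field, 'c) filtered_complex \<Rightarrow> ('k, 'd) filtered_complex \<Rightarrow>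
   (int \<Rightarrow> 'c \<Rightarrow> 'd) \<Rightarrow> bool" where
  "chain_map \<Gamma> C D \<Phi> \<longleftrightarrow>
     (\<forall>k. \<Phi> k \<in> LinearCombinations.module_hom (novikov \<Gamma>) (chains C k) (chains D k)) \<and>
     (\<forall>k. \<forall>c\<in>carrier (chains C k). \<Phi> (k - 1) (bdry C k c) = bdry D k (\<Phi> k c))"

definition chain_interleaving ::
  "real set \<Rightarrow> real \<Rightarrow> ('k::field, 'c) filtered_complex \<Rightarrow> ('k, 'd) filtered_complex \<Rightarrow>
   (int \<Rightarrow> 'c \<Rightarrow> 'd) \<Rightarrow> (int \<Rightarrow> 'd \<Rightarrow> 'c) \<Rightarrow> bool" where
  "chain_interleaving \<Gamma> \<delta> C D \<Phi> \<Psi> \<longleftrightarrow>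
     chain_map \<Gamma> C D \<Phi> \<and> chain_map \<Gamma> D C \<Psi> \<and>
     (\<forall>k. \<forall>c\<in>carrier (chains C k). level D k (\<Phi> k c) \<le> level C k c + ereal \<delta>) \<and>
     (\<forall>k. \<forall>d\<in>carrier (chains D k). level C k (\<Psi> k d) \<le> level D k d + ereal \<delta>) \<and>
     (\<forall>k s. \<forall>X\<in>carrier (homology C k s).
        homology_map C k (s + 2 * \<delta>) (\<Psi> k \<circ> \<Phi> k) X = homology_map C k (s + 2 * \<delta>) id X) \<and>
     (\<forall>k s. \<forall>X\<in>carrier (homology D k s).
        homology_map D k (s + 2 * \<delta>) (\<Phi> k \<circ> \<Psi> k) X = homology_map D k (s + 2 * \<delta>) id X)"

definition quasiequivalence ::
  "real set \<Rightarrow> real \<Rightarrow> ('k::field, 'c) filtered_complex \<Rightarrow> ('k, 'd) filtered_complex \<Rightarrow>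
   (int \<Rightarrow> 'c \<Rightarrow> 'd) \<Rightarrow> (int \<Rightarrow> 'd \<Rightarrow> 'c) \<Rightarrow> (int \<Rightarrow> 'c \<Rightarrow> 'c) \<Rightarrow> (int \<Rightarrow> 'd \<Rightarrow> 'd) \<Rightarrow> bool" where
  "quasiequivalence \<Gamma> \<delta> C D \<Phi> \<Psi> K\<^sub>C K\<^sub>D \<longleftrightarrow>
     chain_map \<Gamma> C D \<Phi> \<and> chain_map \<Gamma> D C \<Psi> \<and>
     (\<forall>k. K\<^sub>C k \<in> LinearCombinations.module_hom (novikov \<Gamma>) (chains C k) (chains C (k + 1))) \<and>
     (\<forall>k. K\<^sub>D k \<in> LinearCombinations.module_hom (novikov \<Gamma>) (chains D k) (chains D (k + 1))) \<and>
     (\<forall>k. \<forall>c\<in>carrier (chains C k).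
        \<Psi> k (\<Phi> k c) \<ominus>\<^bsub>chains C k\<^esub> c =
        bdry C (k + 1) (K\<^sub>C k c) \<oplus>\<^bsub>chains C k\<^esub> K\<^sub>C (k - 1) (bdry C k c)) \<and>
     (\<forall>k. \<forall>d\<in>carrier (chains D k).
        \<Phi> k (\<Psi> k d) \<ominus>\<^bsub>chains D k\<^esub> d =
        bdry D (k + 1) (K\<^sub>D k d) \<oplus>\<^bsub>chains D k\<^esub> K\<^sub>D (k - 1) (bdry D k d)) \<and>
     (\<forall>k. \<forall>c\<in>carrier (chains C k). level D k (\<Phi> k c) \<le> level C k c + ereal \<delta>) \<and>
     (\<forall>k. \<forall>d\<in>carrier (chains D k). level C k (\<Psi> k d) \<le> level D k d + ereal \<delta>) \<and>
     (\<forall>k. \<forall>c\<in>carrier (chains C k).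
        level C (k + 1) (K\<^sub>C k c) \<le> level C k c + ereal (2 * \<delta>)) \<and>
     (\<forall>k. \<forall>d\<in>carrier (chains D k).
        level D (k + 1) (K\<^sub>D k d) \<le> level D k d + ereal (2 * \<delta>))"

end

theory Submission
  imports Defs
begin

text \<open>Let \<open>Z\<close> be the space of cycles in \<open>C\<^sub>k\<close>.  Gaussian elimination, pivoting each time on a coordinate
  of maximal level in an orthogonal basis, produces a level-nonincreasing projection \<open>P\<close> of \<open>C\<^sub>k\<close> with
  kernel \<open>Z\<close>, so that \<open>C\<^sub>k\<close> splits orthogonally as \<open>F \<oplus> Z\<close>.  The given maps \<open>\<Phi>\<close> and \<open>\<Psi>\<close> preserve cycles,
  but their components \<open>F \<rightarrow> Z\<close> are invisible to filtered homology and may obstruct a controlled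
  homotopy, so these components are deleted.  For the new maps \<open>\<Phi>'\<close> and \<open>\<Psi>'\<close> the interleaving condition
  provides, for each cycle \<open>z\<close>, some \<open>y\<close> with \<open>\<partial>y = \<Psi>'\<Phi>'z - z\<close> whose level is at most that of \<open>z\<close> plus
  \<open>2\<delta>\<close>.  Since \<open>\<partial>\<close> is injective on \<open>F\<close>, the element \<open>P y\<close> depends only on \<open>z\<close>; sending \<open>z\<close> to \<open>P y\<close>
  and \<open>F\<close> to zero is therefore linear, and it is the required homotopy.\<close>

section \<open>Level-nonincreasing projections\<close>

lemma (in abelian_group) minus_zero_right [simp]: "x \<in> carrier G \<Longrightarrow> x \<ominus> \<zero> = x"
  by (simp add: a_minus_def a_inv_def)

section \<open>Composites, sums and differences of module homomorphisms\<close>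

lemma module_hom_comp:
  assumes "f \<in> LinearCombinations.module_hom R L M" "g \<in> LinearCombinations.module_hom R M N"
  shows "(\<lambda>x. g (f x)) \<in> LinearCombinations.module_hom R L N"
  using assms unfolding LinearCombinations.module_hom_def by (simp add: Pi_iff)

lemma module_hom_sum:
  assumes N: "Module.module R N"
    and f: "f \<in> LinearCombinations.module_hom R M N" and g: "g \<in> LinearCombinations.module_hom R M N"
  shows "(\<lambda>x. f x \<oplus>\<^bsub>N\<^esub> g x) \<in> LinearCombinations.module_hom R M N"
proof -
  interpret N: Module.module R N by (rule N)
  show ?thesis
    using f g unfolding LinearCombinations.module_hom_def
    by (auto simp: Pi_iff N.smult_r_distr N.M.add.m_ac)
qed

lemma module_hom_diff:
  assumes N: "Module.module R N"
    and f: "f \<in> LinearCombinations.module_hom R M N" and g: "g \<in> LinearCombinations.module_hom R M N"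
  shows "(\<lambda>x. f x \<ominus>\<^bsub>N\<^esub> g x) \<in> LinearCombinations.module_hom R M N"
proof -
  interpret N: Module.module R N by (rule N)
  show ?thesis
    using f g unfolding LinearCombinations.module_hom_def
    by (auto simp: Pi_iff a_minus_def N.smult_r_distr N.smult_r_minus N.M.minus_add N.M.add.m_ac)
qed

context nonarch_normed_space
begin

section \<open>Coordinates in an orthogonal basis and elimination with pivots of maximal
  level\<close>

text \<open>The conditions are spelled out because \<open>module_hom\<close> takes a module as
  target, while \<open>novikov \<Gamma>\<close> is a ring record without scalar
  multiplication.\<close>

definition linear_functional :: "('c \<Rightarrow> real \<Rightarrow> 'k) \<Rightarrow> bool" where
  "linear_functional \<phi> \<longleftrightarrow> \<phi> \<in> carrier V \<rightarrow> carrier (novikov \<Gamma>) \<and>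
     (\<forall>x\<in>carrier V. \<forall>y\<in>carrier V. \<phi> (x \<oplus> y) = \<phi> x \<oplus>\<^bsub>novikov \<Gamma>\<^esub> \<phi> y) \<and>
     (\<forall>a\<in>carrier (novikov \<Gamma>). \<forall>x\<in>carrier V. \<phi> (a \<odot> x) = a \<otimes>\<^bsub>novikov \<Gamma>\<^esub> \<phi> x)"

lemma level_zero [simp]: "lev \<zero> = - \<infinity>"
  by (simp add: level_eq_MInf_iff)

text \<open>Negation is multiplication by the constant series -1, whose valuation is 0.\<close>

lemma level_uminus [simp]:
  assumes "x \<in> carrier V"
  shows "lev (\<ominus> x) = lev x"
proof -
  let ?m = "\<lambda>g::real. if g = 0 then - 1 else (0::'k)"
  \<comment> \<open>That 0 lies in \<Gamma> is read off the unit of the field, which has a nonzero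
    coefficient at the exponent 0.\<close>
  have "(\<lambda>g. if g = 0 then 1 else (0::'k)) \<in> novikov_carrier \<Gamma>"
    using R.one_closed by (simp add: novikov_def)
  then have 0: "0 \<in> \<Gamma>" by (rule novikovD) simp
  then have m: "?m \<in> carrier (novikov \<Gamma>)"
    using novikov_monom_closed[of 0 \<Gamma> "-1 :: 'k"] by (simp add: novikov_def)
  have "?m \<oplus>\<^bsub>novikov \<Gamma>\<^esub> \<one>\<^bsub>novikov \<Gamma>\<^esub> = \<zero>\<^bsub>novikov \<Gamma>\<^esub>"
    by (auto simp: novikov_def)
  then have eq: "\<ominus>\<^bsub>novikov \<Gamma>\<^esub> \<one>\<^bsub>novikov \<Gamma>\<^esub> = ?m"
    using m R.one_closed R.minus_equality by blast
  have "(LEAST g. ?m g \<noteq> 0) = 0" by (rule Least_equality) (auto split: if_splits)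
  moreover have "?m \<noteq> (\<lambda>g. 0)" by (auto simp: fun_eq_iff)
  ultimately have "valuation ?m = 0"
    unfolding valuation_def by simp
  then have "lev (?m \<odot> x) = lev x" using level_smult[OF m assms] by simp
  then show ?thesis using assms by (simp flip: smult_minus_1 eq)
qed

lemma level_diff:
  assumes "x \<in> carrier V" "y \<in> carrier V"
  shows "lev (x \<ominus> y) \<le> max (lev x) (lev y)"
  using level_add[of x "\<ominus> y"] assms by (simp add: a_minus_def)

text \<open>Coefficients exist because the basis spans. They are unique by orthogonality: the level
  of a vanishing combination is -infinity and is the maximum of the levels of its terms, so every
  term vanishes and, the basis vectors being nonzero, every coefficient does. Uniqueness then makes
  the chosen coefficients linear in the vector.\<close>

lemma orthogonal_coordinates:
  assumes ws: "basis (set ws)" "distinct ws" "orthogonal_list \<Gamma> V lev ws"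
  obtains \<phi> where "\<And>i. i < length ws \<Longrightarrow> linear_functional (\<phi> i)"
    and "\<And>x. x \<in> carrier V \<Longrightarrow> lev x = (SUP i\<in>{..<length ws}. lev (\<phi> i x \<odot> ws ! i))"
proof -
  let ?K = "novikov \<Gamma> :: (real \<Rightarrow> 'k) ring"
  let ?n = "length ws"
  let ?I = "{..<?n}"
  let ?s = "\<lambda>a. \<Oplus>i\<in>?I. a i \<odot> ws ! i"
  have inV: "set ws \<subseteq> carrier V" using ws(1) unfolding basis_def by blast
  then have w: "ws ! i \<in> carrier V" if "i < ?n" for i using that by auto
  have "carrier ?K \<noteq> {\<zero>\<^bsub>?K\<^esub>}" using one_not_zero R.one_closed by blast
  then have "\<zero> \<notin> set ws" using ws(1) zero_nin_lin_indpt[OF inV] unfolding basis_def by blast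
  then have wnz: "ws ! i \<noteq> \<zero>" if "i < ?n" for i using that by (metis nth_mem)
  have lev_s: "lev (?s a) = (SUP i\<in>?I. lev (a i \<odot> ws ! i))" if "a \<in> ?I \<rightarrow> carrier ?K" for a
    using ws(3) that unfolding orthogonal_list_def by blast
  have ex: "\<exists>a. a \<in> ?I \<rightarrow> carrier ?K \<and> ?s a = x" if x: "x \<in> carrier V" for x
  proof -
    have "x \<in> span (set ws)" using ws(1) x unfolding basis_def by blast
    then obtain b where b: "b \<in> set ws \<rightarrow> carrier ?K" "lincomb b (set ws) = x"
      using finite_in_span[OF _ inV] by blast
    have img: "set ws = (!) ws ` ?I" by (auto simp: set_conv_nth)
    \<comment> \<open>Distinctness of \<open>ws\<close> turns the sum over the set of basis vectors
      into a sum over indices.\<close>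
    have "x = (\<Oplus>v\<in>(!) ws ` ?I. b v \<odot> v)" using b(2) img by (simp add: lincomb_def)
    also have "\<dots> = ?s (\<lambda>i. b (ws ! i))"
      using ws(2) b(1) inV by (intro finsum_reindex) (auto simp: img inj_on_def nth_eq_iff_index_eq)
    finally show ?thesis using b(1) by (intro exI[of _ "\<lambda>i. b (ws ! i)"]) auto
  qed
  have zero: "a i = \<zero>\<^bsub>?K\<^esub>" if a: "a \<in> ?I \<rightarrow> carrier ?K" "?s a = \<zero>" "i < ?n" for a i
  proof (rule ccontr)
    assume "a i \<noteq> \<zero>\<^bsub>?K\<^esub>"
    moreover have ai: "a i \<in> carrier ?K" using a by auto
    ultimately have "a i \<in> Units ?K" by (simp add: field_Units)
    then obtain b where b: "b \<in> carrier ?K" "b \<otimes>\<^bsub>?K\<^esub> a i = \<one>\<^bsub>?K\<^esub>"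
      using R.Units_inv_closed R.Units_l_inv by blast
    have "lev (a i \<odot> ws ! i) \<le> (SUP i\<in>?I. lev (a i \<odot> ws ! i))"
      using a(3) by (intro SUP_upper) simp
    also have "\<dots> = - \<infinity>" unfolding lev_s[OF a(1), symmetric] a(2) by (rule level_zero)
    finally have "lev (a i \<odot> ws ! i) \<le> - \<infinity>" .
    then have "a i \<odot> ws ! i = \<zero>" using level_eq_MInf_iff[of "a i \<odot> ws ! i"] w[OF a(3)] ai by simp
    then have "b \<odot> (a i \<odot> ws ! i) = \<zero>" using b by simp
    then have "ws ! i = \<zero>" using b ai w[OF a(3)] by (simp flip: smult_assoc1)
    then show False using wnz a(3) by blast
  qed
  have s_closed: "?s a \<in> carrier V" if "a \<in> ?I \<rightarrow> carrier ?K" for a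
    using that w by (intro finsum_closed) auto
  have s_add: "?s (\<lambda>i. a i \<oplus>\<^bsub>?K\<^esub> b i) = ?s a \<oplus> ?s b"
    if ab: "a \<in> ?I \<rightarrow> carrier ?K" "b \<in> ?I \<rightarrow> carrier ?K" for a b
  proof -
    have "?s (\<lambda>i. a i \<oplus>\<^bsub>?K\<^esub> b i) = (\<Oplus>i\<in>?I. a i \<odot> ws ! i \<oplus> b i \<odot> ws ! i)"
      using ab w by (intro finsum_cong') (auto simp: Pi_iff smult_l_distr)
    also have "\<dots> = ?s a \<oplus> ?s b" using ab w by (intro finsum_addf) auto
    finally show ?thesis .
  qed
  have s_smult: "?s (\<lambda>i. c \<otimes>\<^bsub>?K\<^esub> a i) = c \<odot> ?s a"
    if ac: "a \<in> ?I \<rightarrow> carrier ?K" "c \<in> carrier ?K" for a c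
  proof -
    have "?s (\<lambda>i. c \<otimes>\<^bsub>?K\<^esub> a i) = (\<Oplus>i\<in>?I. c \<odot> (a i \<odot> ws ! i))"
      using ac w by (intro finsum_cong') (auto simp: Pi_iff smult_assoc1)
    also have "\<dots> = c \<odot> ?s a" using ac w by (intro finsum_smult_ldistr[symmetric]) auto
    finally show ?thesis .
  qed
  have unique: "a i = b i"
    if ab: "a \<in> ?I \<rightarrow> carrier ?K" "b \<in> ?I \<rightarrow> carrier ?K" "?s a = ?s b" "i < ?n" for a b i
  proof -
    have i: "a i \<in> carrier ?K" "b i \<in> carrier ?K" using ab by auto
    have c: "(\<lambda>i. a i \<ominus>\<^bsub>?K\<^esub> b i) \<in> ?I \<rightarrow> carrier ?K" using ab by auto
    have "?s (\<lambda>i. a i \<ominus>\<^bsub>?K\<^esub> b i) \<oplus> ?s b = ?s (\<lambda>i. (a i \<ominus>\<^bsub>?K\<^esub> b i) \<oplus>\<^bsub>?K\<^esub> b i)"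
      using s_add[OF c ab(2)] by simp
    also have "\<dots> = ?s a"
      using ab w by (intro finsum_cong') (auto simp: Pi_iff R.minus_eq R.add.m_assoc R.l_neg)
    also have "\<dots> = ?s b" by (rule ab(3))
    finally have "?s (\<lambda>i. a i \<ominus>\<^bsub>?K\<^esub> b i) = \<zero>"
      using M.add.r_cancel_one s_closed[OF c] s_closed[OF ab(2)] by blast
    then have "a i \<ominus>\<^bsub>?K\<^esub> b i = \<zero>\<^bsub>?K\<^esub>" using zero[OF c] ab by blast
    then show ?thesis using i by simp
  qed
  define c where "c x = (SOME a. a \<in> ?I \<rightarrow> carrier ?K \<and> ?s a = x)" for x
  have c: "c x \<in> ?I \<rightarrow> carrier ?K" "?s (c x) = x" if "x \<in> carrier V" for x
    unfolding c_def using someI_ex[OF ex[OF that]] by blast+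
  show thesis
  proof (rule that[of "\<lambda>i x. c x i"])
    have "c x i \<in> carrier ?K" if "i < ?n" "x \<in> carrier V" for i x
      using c that by auto
    moreover have "c (x \<oplus> y) i = c x i \<oplus>\<^bsub>?K\<^esub> c y i"
      if "i < ?n" "x \<in> carrier V" "y \<in> carrier V" for i x y
      using that c[of x] c[of y] c[of "x \<oplus> y"] s_add[of "c x" "c y"]
      by (intro unique[of "c (x \<oplus> y)" "\<lambda>i. c x i \<oplus>\<^bsub>?K\<^esub> c y i"]) (auto simp: Pi_iff)
    moreover have "c (a \<odot> x) i = a \<otimes>\<^bsub>?K\<^esub> c x i"
      if "i < ?n" "a \<in> carrier ?K" "x \<in> carrier V" for i a x
      using that c[of x] c[of "a \<odot> x"] s_smult[of "c x" a]
      by (intro unique[of "c (a \<odot> x)" "\<lambda>i. a \<otimes>\<^bsub>?K\<^esub> c x i"]) (auto simp: Pi_iff)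
    ultimately show "linear_functional (\<lambda>x. c x i)" if "i < ?n" for i
      using that unfolding linear_functional_def by auto
    show "lev x = (SUP i\<in>?I. lev (c x i \<odot> ws ! i))" if "x \<in> carrier V" for x
      using c[OF that] lev_s[of "c x"] by simp
  qed
qed

text \<open>One elimination step: \<open>P x\<close> is x - (\<phi> x / \<phi> w) w, the translate
  of x along w at which \<phi> vanishes. In the application \<open>e\<close> is the basis vector
  belonging to the coordinate \<phi>, and \<open>pivot\<close> says that this coordinate carries the
  full level of w; this is what keeps the correction from exceeding the level of x.\<close>

lemma pivot_projection:
  assumes \<phi>: "linear_functional \<phi>" and e: "e \<in> carrier V"
    and le: "\<And>x. x \<in> carrier V \<Longrightarrow> lev (\<phi> x \<odot> e) \<le> lev x"
    and w: "w \<in> carrier V" "w \<noteq> \<zero>" and pivot: "lev (\<phi> w \<odot> e) = lev w"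
  obtains P where "P \<in> LinearCombinations.module_hom (novikov \<Gamma>) V V"
    and "\<And>x. x \<in> carrier V \<Longrightarrow> lev (P x) \<le> lev x"
    and "\<And>x. x \<in> carrier V \<Longrightarrow> \<phi> (P x) = \<zero>\<^bsub>novikov \<Gamma>\<^esub>"
    and "\<And>x. x \<in> carrier V \<Longrightarrow> \<exists>c\<in>carrier (novikov \<Gamma>). P x = x \<oplus> c \<odot> w"
proof -
  let ?K = "novikov \<Gamma> :: (real \<Rightarrow> 'k) ring"
  have closed: "\<phi> x \<in> carrier ?K" if "x \<in> carrier V" for x
    using \<phi> that unfolding linear_functional_def by blast
  have \<phi>_add: "\<phi> (x \<oplus> y) = \<phi> x \<oplus>\<^bsub>?K\<^esub> \<phi> y" if "x \<in> carrier V" "y \<in> carrier V" for x y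
    using \<phi> that unfolding linear_functional_def by blast
  have \<phi>_smult: "\<phi> (a \<odot> x) = a \<otimes>\<^bsub>?K\<^esub> \<phi> x" if "a \<in> carrier ?K" "x \<in> carrier V" for a x
    using \<phi> that unfolding linear_functional_def by blast
  have "lev w \<noteq> - \<infinity>" using w level_eq_MInf_iff by blast
  then have "\<phi> w \<noteq> \<zero>\<^bsub>?K\<^esub>" using pivot e by auto
  then have "\<phi> w \<in> Units ?K" using closed w by (simp add: field_Units)
  then obtain u where u: "u \<in> carrier ?K" "u \<otimes>\<^bsub>?K\<^esub> \<phi> w = \<one>\<^bsub>?K\<^esub>"
    using R.Units_inv_closed R.Units_l_inv by blast
  define c where "c x = (\<ominus>\<^bsub>?K\<^esub> u) \<otimes>\<^bsub>?K\<^esub> \<phi> x" for x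
  define P where "P x = x \<oplus> c x \<odot> w" for x
  have c: "c x \<in> carrier ?K" if "x \<in> carrier V" for x
    unfolding c_def using u closed that by simp
  have c_add: "c (x \<oplus> y) = c x \<oplus>\<^bsub>?K\<^esub> c y" if "x \<in> carrier V" "y \<in> carrier V" for x y
    unfolding c_def using u closed that \<phi>_add R.r_distr by simp
  have c_smult: "c (a \<odot> x) = a \<otimes>\<^bsub>?K\<^esub> c x" if "a \<in> carrier ?K" "x \<in> carrier V" for a x
    unfolding c_def using u closed[OF that(2)] that \<phi>_smult R.m_lcomm by simp
  have c_pivot: "c x \<otimes>\<^bsub>?K\<^esub> \<phi> w = \<ominus>\<^bsub>?K\<^esub> \<phi> x" if "x \<in> carrier V" for x
  proof -
    have "c x \<otimes>\<^bsub>?K\<^esub> \<phi> w = \<ominus>\<^bsub>?K\<^esub> ((u \<otimes>\<^bsub>?K\<^esub> \<phi> x) \<otimes>\<^bsub>?K\<^esub> \<phi> w)"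
      unfolding c_def using u closed[OF that] closed[OF w(1)] by (simp add: R.l_minus)
    also have "(u \<otimes>\<^bsub>?K\<^esub> \<phi> x) \<otimes>\<^bsub>?K\<^esub> \<phi> w = \<phi> x \<otimes>\<^bsub>?K\<^esub> (u \<otimes>\<^bsub>?K\<^esub> \<phi> w)"
      using u(1) closed[OF that] closed[OF w(1)] by (simp add: R.m_ac)
    also have "\<dots> = \<phi> x" using u(2) closed[OF that] by simp
    finally show ?thesis .
  qed
  show thesis
  proof (rule that[of P])
    have "P x \<in> carrier V" if "x \<in> carrier V" for x
      unfolding P_def using that c w by simp
    moreover have "P (x \<oplus> y) = P x \<oplus> P y" if "x \<in> carrier V" "y \<in> carrier V" for x y
      unfolding P_def using that c[of x] c[of y] w by (simp add: c_add smult_l_distr M.add.m_ac)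
    moreover have "P (a \<odot> x) = a \<odot> P x" if "a \<in> carrier ?K" "x \<in> carrier V" for a x
      unfolding P_def using that c[of x] w by (simp add: c_smult smult_r_distr smult_assoc1)
    ultimately show "P \<in> LinearCombinations.module_hom ?K V V" unfolding LinearCombinations.module_hom_def by auto
    show "\<phi> (P x) = \<zero>\<^bsub>?K\<^esub>" if "x \<in> carrier V" for x
      unfolding P_def using that c w closed
      by (simp add: \<phi>_add \<phi>_smult c_pivot R.r_neg)
    show "\<exists>a\<in>carrier ?K. P x = x \<oplus> a \<odot> w" if "x \<in> carrier V" for x
      unfolding P_def using c that by blast
    show "lev (P x) \<le> lev x" if x: "x \<in> carrier V" for x
    proof -
      have fw: "\<phi> w \<odot> e \<in> carrier V" using closed w e by simp
      \<comment> \<open>The level of a multiple of w depends only on the scalar and on the level of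
        w. Hence w may be exchanged for \<open>\<phi> w \<odot> e\<close>, and the product of
        scalars becomes the negative of \<open>\<phi> x\<close>.\<close>
      have "lev (c x \<odot> w) = lev (c x \<odot> (\<phi> w \<odot> e))"
        using level_smult[OF c[OF x] w(1)] level_smult[OF c[OF x] fw] pivot by simp
      also have "c x \<odot> (\<phi> w \<odot> e) = (c x \<otimes>\<^bsub>?K\<^esub> \<phi> w) \<odot> e"
        using smult_assoc1[OF c[OF x] closed[OF w(1)] e] by simp
      also have "\<dots> = \<ominus> (\<phi> x \<odot> e)"
        using c_pivot[OF x] smult_l_minus[OF closed[OF x] e] by simp
      also have "lev \<dots> = lev (\<phi> x \<odot> e)" using closed[OF x] e by simp
      also have "\<dots> \<le> lev x" using le[OF x] .
      finally show ?thesis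
        unfolding P_def using level_add[OF x, of "c x \<odot> w"] c[OF x] w(1) by fastforce
    qed
  qed
qed

text \<open>Here \<open>J\<close> is the set of coordinates still available as pivots, and
  \<open>P\<close> has to kill only those elements of W whose coordinates outside \<open>J\<close>
  vanish. If such an element w is nonzero, one of its coordinates of maximal level is cleared, and
  the induction continues with this coordinate removed from \<open>J\<close>.\<close>

lemma coordinate_projection:
  fixes e :: "nat \<Rightarrow> 'c"
  assumes W: "submodule (novikov \<Gamma>) W V"
    and \<phi>: "\<And>i. i \<in> I \<Longrightarrow> linear_functional (\<phi> i)" and e: "\<And>i. i \<in> I \<Longrightarrow> e i \<in> carrier V"
    and le: "\<And>i x. i \<in> I \<Longrightarrow> x \<in> carrier V \<Longrightarrow> lev (\<phi> i x \<odot> e i) \<le> lev x"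
    and max: "\<And>x. x \<in> carrier V \<Longrightarrow> x \<noteq> \<zero> \<Longrightarrow> \<exists>i\<in>I. lev (\<phi> i x \<odot> e i) = lev x"
    and "finite J" "J \<subseteq> I"
  shows "\<exists>P. P \<in> LinearCombinations.module_hom (novikov \<Gamma>) V V \<and>
    (\<forall>x\<in>carrier V. lev (P x) \<le> lev x \<and> P x \<ominus> x \<in> W \<and>
      (x \<in> W \<longrightarrow> (\<forall>i\<in>I - J. \<phi> i x = \<zero>\<^bsub>novikov \<Gamma>\<^esub>) \<longrightarrow> P x = \<zero>))"
  using \<open>finite J\<close> \<open>J \<subseteq> I\<close>
proof (induction J rule: finite_psubset_induct)
  case (psubset J)
  let ?K = "novikov \<Gamma> :: (real \<Rightarrow> 'k) ring"
  interpret W: submodule ?K W V by (rule W)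
  show ?case
  proof (cases "\<exists>w\<in>W. w \<noteq> \<zero> \<and> (\<forall>i\<in>I - J. \<phi> i w = \<zero>\<^bsub>?K\<^esub>)")
    \<comment> \<open>An element that \<open>P\<close> is required to kill is then already zero, so
      the identity serves.\<close>
    case False
    have "(\<lambda>x. x) \<in> LinearCombinations.module_hom ?K V V" by (simp add: LinearCombinations.module_hom_def)
    moreover have "x \<ominus> x \<in> W" if "x \<in> carrier V" for x
      using that W.zero_closed by (simp add: a_minus_def M.r_neg)
    ultimately show ?thesis using False by (intro exI[of _ "\<lambda>x. x"]) auto
  next
    case True
    then obtain w where w: "w \<in> W" "w \<noteq> \<zero>" "\<And>i. i \<in> I - J \<Longrightarrow> \<phi> i w = \<zero>\<^bsub>?K\<^esub>" by blast
    have wV: "w \<in> carrier V" using w(1) W.subset by blast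
    obtain p where p: "p \<in> I" "lev (\<phi> p w \<odot> e p) = lev w" using max[OF wV w(2)] by blast
    \<comment> \<open>The pivot coordinate of w is nonzero because the level of w is finite, whereas
      the coordinates of w outside \<open>J\<close> vanish; so the pivot lies in
      \<open>J\<close>.\<close>
    have "lev w \<noteq> - \<infinity>" using wV w(2) level_eq_MInf_iff by blast
    then have "\<phi> p w \<noteq> \<zero>\<^bsub>?K\<^esub>" using p e by auto
    then have pJ: "p \<in> J" using w(3) p(1) by blast
    obtain P where P: "P \<in> LinearCombinations.module_hom ?K V V"
      and P_lev: "\<And>x. x \<in> carrier V \<Longrightarrow> lev (P x) \<le> lev x"
      and P_zero: "\<And>x. x \<in> carrier V \<Longrightarrow> \<phi> p (P x) = \<zero>\<^bsub>?K\<^esub>"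
      and P_eq: "\<And>x. x \<in> carrier V \<Longrightarrow> \<exists>c\<in>carrier ?K. P x = x \<oplus> c \<odot> w"
      using pivot_projection[OF \<phi>[OF p(1)] e[OF p(1)] le[OF p(1)] wV w(2) p(2)] by blast
    have "J - {p} \<subset> J" "J - {p} \<subseteq> I" using pJ psubset.prems by auto
    then obtain Q where Q: "Q \<in> LinearCombinations.module_hom ?K V V"
      and Q_lev: "\<And>x. x \<in> carrier V \<Longrightarrow> lev (Q x) \<le> lev x"
      and Q_diff: "\<And>x. x \<in> carrier V \<Longrightarrow> Q x \<ominus> x \<in> W"
      and Q_zero: "\<And>x. x \<in> carrier V \<Longrightarrow> x \<in> W \<Longrightarrow>
        (\<forall>i\<in>I - (J - {p}). \<phi> i x = \<zero>\<^bsub>?K\<^esub>) \<Longrightarrow> Q x = \<zero>"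
      using psubset.IH[of "J - {p}"] by blast
    have PV: "P x \<in> carrier V" if "x \<in> carrier V" for x
      using P that unfolding LinearCombinations.module_hom_def by blast
    have QV: "Q x \<in> carrier V" if "x \<in> carrier V" for x
      using Q that unfolding LinearCombinations.module_hom_def by blast
    have hom: "(\<lambda>x. Q (P x)) \<in> LinearCombinations.module_hom ?K V V" using P Q by (rule module_hom_comp)
    have lev: "lev (Q (P x)) \<le> lev x" if "x \<in> carrier V" for x
      using Q_lev[OF PV[OF that]] P_lev[OF that] by (rule order_trans)
    have diff: "Q (P x) \<ominus> x \<in> W" if x: "x \<in> carrier V" for x
    proof -
      obtain c where c: "c \<in> carrier ?K" "P x = x \<oplus> c \<odot> w" using P_eq[OF x] by blast
      have cw: "c \<odot> w \<in> carrier V" using c wV by simp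
      have "Q (P x) \<ominus> x = (Q (P x) \<ominus> P x) \<oplus> c \<odot> w"
        unfolding c(2) using x cw QV[of "x \<oplus> c \<odot> w"]
          by (simp add: a_minus_def M.minus_add M.add.m_ac M.l_neg M.r_neg M.r_neg1 M.r_neg2)
      then show ?thesis using W.m_closed[OF Q_diff[OF PV[OF x]]] c(1) w(1) by simp
    qed
    have zero: "Q (P x) = \<zero>"
      if x: "x \<in> carrier V" "x \<in> W" "\<forall>i\<in>I - J. \<phi> i x = \<zero>\<^bsub>?K\<^esub>" for x
    proof (rule Q_zero[OF PV[OF x(1)]])
      obtain c where c: "c \<in> carrier ?K" "P x = x \<oplus> c \<odot> w" using P_eq[OF x(1)] by blast
      show "P x \<in> W" using c x(2) w(1) by simp
      \<comment> \<open>\<open>P\<close> clears the coordinate \<open>p\<close>. The coordinates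
        outside \<open>J\<close> vanish both on x and on w, hence on x + c w.\<close>
      show "\<forall>i\<in>I - (J - {p}). \<phi> i (P x) = \<zero>\<^bsub>?K\<^esub>"
      proof
        fix i assume i: "i \<in> I - (J - {p})"
        show "\<phi> i (P x) = \<zero>\<^bsub>?K\<^esub>"
        proof (cases "i = p")
          case True
          then show ?thesis using P_zero x(1) by simp
        next
          case False
          then have "i \<in> I" "\<phi> i x = \<zero>\<^bsub>?K\<^esub>" "\<phi> i w = \<zero>\<^bsub>?K\<^esub>" using i x(3) w(3) by auto
          then show ?thesis using \<phi>[of i] c x(1) wV unfolding linear_functional_def by simp
        qed
      qed
    qed
    show ?thesis using hom lev diff zero by (intro exI[of _ "\<lambda>x. Q (P x)"]) simp
  qed
qed

text \<open>Taking \<open>J = I\<close> makes the vanishing condition of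
  \<open>coordinate_projection\<close> vacuous, so that \<open>P\<close> kills all of W.\<close>

lemma contracting_projection:
  assumes V: "orthogonalizable \<Gamma> V lev" and W: "submodule (novikov \<Gamma>) W V"
  obtains P where "P \<in> LinearCombinations.module_hom (novikov \<Gamma>) V V"
    and "\<And>x. x \<in> carrier V \<Longrightarrow> lev (P x) \<le> lev x"
    and "\<And>x. x \<in> carrier V \<Longrightarrow> P x \<ominus> x \<in> W"
    and "\<And>x. x \<in> W \<Longrightarrow> P x = \<zero>"
proof -
  obtain ws where ws: "basis (set ws)" "distinct ws" "orthogonal_list \<Gamma> V lev ws"
    using V unfolding orthogonalizable_def by blast
  let ?I = "{..<length ws}"
  obtain \<phi> where \<phi>: "\<And>i. i < length ws \<Longrightarrow> linear_functional (\<phi> i)"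
    and sup: "\<And>x. x \<in> carrier V \<Longrightarrow> lev x = (SUP i\<in>?I. lev (\<phi> i x \<odot> ws ! i))"
    using orthogonal_coordinates[OF ws] by blast
  have le: "lev (\<phi> i x \<odot> ws ! i) \<le> lev x" if "i \<in> ?I" "x \<in> carrier V" for i x
    unfolding sup[OF that(2)] using that(1) by (rule SUP_upper)
  have max: "\<exists>i\<in>?I. lev (\<phi> i x \<odot> ws ! i) = lev x" if x: "x \<in> carrier V" "x \<noteq> \<zero>" for x
  proof -
    let ?S = "(\<lambda>i. lev (\<phi> i x \<odot> ws ! i)) ` ?I"
    \<comment> \<open>The supremum over no indices is -infinity. A nonzero x therefore forces the
      index set to be nonempty, and a supremum over a finite nonempty set is attained.\<close>
    have "lev x \<noteq> - \<infinity>" using x level_eq_MInf_iff by blast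
    then have ne: "?S \<noteq> {}" using sup[OF x(1)] by (auto simp: bot_ereal_def)
    have "lev x = Max ?S" using sup[OF x(1)] ne by (simp add: Max_Sup)
    moreover have "Max ?S \<in> ?S" using ne by (intro Max_in) auto
    ultimately show ?thesis by auto
  qed
  have e: "ws ! i \<in> carrier V" if "i \<in> ?I" for i
    using ws(1) that unfolding basis_def by auto
  have "W \<subseteq> carrier V" using W by (rule submodule.subset)
  obtain P where "P \<in> LinearCombinations.module_hom (novikov \<Gamma>) V V"
    and "\<forall>x\<in>carrier V. lev (P x) \<le> lev x \<and> P x \<ominus> x \<in> W \<and> (x \<in> W \<longrightarrow> P x = \<zero>)"
    using coordinate_projection[OF W, of ?I \<phi> "\<lambda>i. ws ! i" ?I] \<phi> le max e by auto
  then show thesis using \<open>W \<subseteq> carrier V\<close> by (intro that[of P]) auto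
qed

end

section \<open>Complexes split along their cycles\<close>

locale floer_complex =
  fixes \<Gamma> :: "real set" and C :: "('k::field, 'c) filtered_complex"
  assumes floer_type_complex: "floer_type_complex \<Gamma> C"

sublocale floer_complex \<subseteq> chain: nonarch_normed_space \<Gamma> "chains C k" "level C k" for k
  using floer_type_complex unfolding floer_type_complex_def orthogonalizable_def by blast

sublocale floer_complex \<subseteq> d: mod_hom "novikov \<Gamma>" "chains C k" "chains C (k - 1)" "bdry C k" for k
proof unfold_locales
  show "bdry C k \<in> LinearCombinations.module_hom (novikov \<Gamma>) (chains C k) (chains C (k - 1))"
    using floer_type_complex unfolding floer_type_complex_def by blast
qed

context floer_complex
begin

lemma bdry_bdry [simp]:
  "x \<in> carrier (chains C k) \<Longrightarrow> bdry C (k - 1) (bdry C k x) = \<zero>\<^bsub>chains C (k - 2)\<^esub>"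
  using floer_type_complex unfolding floer_type_complex_def by blast

text \<open>These conditions make \<open>P\<close> idempotent, with the cycles as kernel and an orthogonal complement as image.\<close>

definition splitting :: "(int \<Rightarrow> 'c \<Rightarrow> 'c) \<Rightarrow> bool" where
  "splitting P \<longleftrightarrow>
     (\<forall>k. P k \<in> LinearCombinations.module_hom (novikov \<Gamma>) (chains C k) (chains C k)) \<and>
     (\<forall>k. \<forall>x\<in>carrier (chains C k). level C k (P k x) \<le> level C k x) \<and>
     (\<forall>k. \<forall>x\<in>carrier (chains C k). bdry C k (P k x) = bdry C k x) \<and>
     (\<forall>k. \<forall>x\<in>carrier (chains C k). bdry C k x = \<zero>\<^bsub>chains C (k - 1)\<^esub> \<longrightarrow>
        P k x = \<zero>\<^bsub>chains C k\<^esub>)"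

text \<open>In each degree the projection is taken along the submodule of cycles. That
  \<open>p x\<close> and x differ by a cycle then says that they have the same boundary.\<close>

lemma splitting_exists: "\<exists>P. splitting P"
proof -
  have "\<exists>p. p \<in> LinearCombinations.module_hom (novikov \<Gamma>) (chains C k) (chains C k) \<and>
     (\<forall>x\<in>carrier (chains C k). level C k (p x) \<le> level C k x) \<and>
     (\<forall>x\<in>carrier (chains C k). bdry C k (p x) = bdry C k x) \<and>
     (\<forall>x\<in>carrier (chains C k). bdry C k x = \<zero>\<^bsub>chains C (k - 1)\<^esub> \<longrightarrow> p x = \<zero>\<^bsub>chains C k\<^esub>)" for k
  proof -
    have "orthogonalizable \<Gamma> (chains C k) (level C k)"
      using floer_type_complex unfolding floer_type_complex_def by blast
    then obtain p where p: "p \<in> LinearCombinations.module_hom (novikov \<Gamma>) (chains C k) (chains C k)"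
      and lev: "\<And>x. x \<in> carrier (chains C k) \<Longrightarrow> level C k (p x) \<le> level C k x"
      and ker: "\<And>x. x \<in> carrier (chains C k) \<Longrightarrow> p x \<ominus>\<^bsub>chains C k\<^esub> x \<in> d.ker k"
      and zero: "\<And>x. x \<in> d.ker k \<Longrightarrow> p x = \<zero>\<^bsub>chains C k\<^esub>"
      using chain.contracting_projection[OF _ d.ker_is_submodule] by blast
    have "bdry C k (p x) = bdry C k x" if x: "x \<in> carrier (chains C k)" for x
    proof -
      have px: "p x \<in> carrier (chains C k)" using p x by (auto dest: module_hom_closed)
      have "bdry C k (p x) \<ominus>\<^bsub>chains C (k - 1)\<^esub> bdry C k x = \<zero>\<^bsub>chains C (k - 1)\<^esub>"
        using d.f_ker[OF ker[OF x]] d.f_minus[OF px x] by simp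
      then show ?thesis using px x by simp
    qed
    then show ?thesis using p lev zero unfolding d.ker_def by (intro exI[of _ p]) simp
  qed
  then show ?thesis unfolding splitting_def by metis
qed

end

locale split_floer_complex = floer_complex \<Gamma> C
  for \<Gamma> :: "real set" and C :: "('k::field, 'c) filtered_complex" +
  fixes P :: "int \<Rightarrow> 'c \<Rightarrow> 'c"
  assumes splitting: "splitting P"

sublocale split_floer_complex \<subseteq> P: mod_hom "novikov \<Gamma>" "chains C k" "chains C k" "P k" for k
proof unfold_locales
  show "P k \<in> LinearCombinations.module_hom (novikov \<Gamma>) (chains C k) (chains C k)"
    using splitting unfolding splitting_def by blast
qed

context split_floer_complex
begin

lemma level_P: "x \<in> carrier (chains C k) \<Longrightarrow> level C k (P k x) \<le> level C k x"
  using splitting unfolding splitting_def by blast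

lemma bdry_P [simp]: "x \<in> carrier (chains C k) \<Longrightarrow> bdry C k (P k x) = bdry C k x"
  using splitting unfolding splitting_def by blast

lemma P_cycle:
  "x \<in> carrier (chains C k) \<Longrightarrow> bdry C k x = \<zero>\<^bsub>chains C (k - 1)\<^esub> \<Longrightarrow> P k x = \<zero>\<^bsub>chains C k\<^esub>"
  using splitting unfolding splitting_def by blast

lemma P_bdry [simp]:
  "x \<in> carrier (chains C k) \<Longrightarrow> P (k - 1) (bdry C k x) = \<zero>\<^bsub>chains C (k - 1)\<^esub>"
  \<comment> \<open>The rule \<open>diff_diff_eq\<close> matches the degree (k - 1) - 1 with the k -
    2 of \<open>bdry_bdry\<close>.\<close>
  by (rule P_cycle) (simp_all add: diff_diff_eq)

text \<open>The difference x - y is a cycle, hence killed by \<open>P\<close>. On the image of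
  \<open>P\<close> this is injectivity of the boundary operator.\<close>

lemma P_eq_if_bdry_eq:
  assumes "x \<in> carrier (chains C k)" "y \<in> carrier (chains C k)" "bdry C k x = bdry C k y"
  shows "P k x = P k y"
proof -
  have "P k (x \<ominus>\<^bsub>chains C k\<^esub> y) = \<zero>\<^bsub>chains C k\<^esub>"
    using assms by (intro P_cycle) (simp_all add: d.f_minus)
  then show ?thesis using assms by (simp add: P.f_minus)
qed

lemma P_P [simp]: "x \<in> carrier (chains C k) \<Longrightarrow> P k (P k x) = P k x"
  by (rule P_eq_if_bdry_eq) simp_all

lemma level_minus_P:
  assumes "x \<in> carrier (chains C k)"
  shows "level C k (x \<ominus>\<^bsub>chains C k\<^esub> P k x) \<le> level C k x"
  using chain.level_diff[of x k "P k x"] level_P[of x k] assms by simp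

lemma bdry_minus_P:
  "x \<in> carrier (chains C k) \<Longrightarrow> bdry C k (x \<ominus>\<^bsub>chains C k\<^esub> P k x) = \<zero>\<^bsub>chains C (k - 1)\<^esub>"
  by (simp add: d.f_minus)

text \<open>The homotopy is forced once it is required to kill the complement and to take values in it:
  there the boundary operator is injective.\<close>

lemma homotopy_exists:
  assumes M: "chain_map \<Gamma> C C M"
    and comm: "\<And>k x. x \<in> carrier (chains C k) \<Longrightarrow> P k (M k x) = M k (P k x)"
    and bound: "\<And>k z. z \<in> carrier (chains C k) \<Longrightarrow> bdry C k z = \<zero>\<^bsub>chains C (k - 1)\<^esub> \<Longrightarrow>
      \<exists>y\<in>carrier (chains C (k + 1)). level C (k + 1) y \<le> level C k z + \<epsilon> \<and>
        bdry C (k + 1) y = M k z \<ominus>\<^bsub>chains C k\<^esub> z"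
  obtains K where
    "\<And>k. K k \<in> LinearCombinations.module_hom (novikov \<Gamma>) (chains C k) (chains C (k + 1))"
    and "\<And>k x. x \<in> carrier (chains C k) \<Longrightarrow>
      M k x \<ominus>\<^bsub>chains C k\<^esub> x = bdry C (k + 1) (K k x) \<oplus>\<^bsub>chains C k\<^esub> K (k - 1) (bdry C k x)"
    and "\<And>k x. x \<in> carrier (chains C k) \<Longrightarrow> level C (k + 1) (K k x) \<le> level C k x + \<epsilon>"
proof -
  interpret M: mod_hom "novikov \<Gamma>" "chains C k" "chains C k" "M k" for k
    by unfold_locales (use M in \<open>auto simp: chain_map_def\<close>)
  have M_bdry: "M (k - 1) (bdry C k x) = bdry C k (M k x)" if "x \<in> carrier (chains C k)" for k x
    using M that unfolding chain_map_def by blast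
  let ?z = "\<lambda>k x. x \<ominus>\<^bsub>chains C k\<^esub> P k x"
  \<comment> \<open>Since the homotopy is to vanish on the image of \<open>P\<close>, only the cycle
    component \<open>?z k x\<close> matters: \<open>A\<close> is \<open>M\<close> minus the identity
    applied to it, and \<open>K k x\<close> is to be a chain in the image of \<open>P\<close> with
    boundary \<open>A k x\<close>.\<close>
  define A where "A k x = M k (?z k x) \<ominus>\<^bsub>chains C k\<^esub> ?z k x" for k x
  define K where "K k x = P (k + 1) (SOME y. y \<in> carrier (chains C (k + 1)) \<and>
    bdry C (k + 1) y = A k x)" for k x
  \<comment> \<open>The target is stated in degree k, where \<open>d.f_hom\<close> gives (k + 1) -
    1.\<close>
  have b_hom: "bdry C (k + 1) \<in> LinearCombinations.module_hom (novikov \<Gamma>) (chains C (k + 1)) (chains C k)"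
    for k using d.f_hom[of "k + 1"] by simp
  have P_cong: "P (k + 1) y = P (k + 1) y'"
    if "y \<in> carrier (chains C (k + 1))" "y' \<in> carrier (chains C (k + 1))"
      "bdry C (k + 1) y = bdry C (k + 1) y'" for k y y'
    using that by (rule P_eq_if_bdry_eq)
  have A_hom: "A k \<in> LinearCombinations.module_hom (novikov \<Gamma>) (chains C k) (chains C k)" for k
  proof -
    have "(\<lambda>x. x) \<in> LinearCombinations.module_hom (novikov \<Gamma>) (chains C k) (chains C k)"
      by (simp add: LinearCombinations.module_hom_def)
    then have z: "?z k \<in> LinearCombinations.module_hom (novikov \<Gamma>) (chains C k) (chains C k)"
      using P.f_hom by (rule module_hom_diff[OF chain.module_axioms])
    show ?thesis
      unfolding A_def using module_hom_comp[OF z M.f_hom] z by (rule module_hom_diff[OF chain.module_axioms])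
  qed
  have ex: "\<exists>y\<in>carrier (chains C (k + 1)). level C (k + 1) y \<le> level C k x + \<epsilon> \<and>
      bdry C (k + 1) y = A k x" if x: "x \<in> carrier (chains C k)" for k x
  proof -
    have "?z k x \<in> carrier (chains C k)" using x by simp
    from bound[OF this bdry_minus_P[OF x]]
    obtain y where "y \<in> carrier (chains C (k + 1))"
      and "level C (k + 1) y \<le> level C k (?z k x) + \<epsilon>" "bdry C (k + 1) y = A k x"
      unfolding A_def by blast
    moreover have "level C k (?z k x) + \<epsilon> \<le> level C k x + \<epsilon>"
      using level_minus_P[OF x] by (rule add_right_mono)
    ultimately show ?thesis by (meson order_trans)
  qed
  \<comment> \<open>Any chain with boundary \<open>A k x\<close> computes \<open>K k x\<close>, as
    \<open>P\<close> does not see the choice. Linearity of \<open>K\<close>, its level bound and its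
    values on boundaries all come from inserting a suitable y.\<close>
  have K_eq: "K k x = P (k + 1) y"
    if x: "x \<in> carrier (chains C k)" and y: "y \<in> carrier (chains C (k + 1))" "bdry C (k + 1) y = A k x"
    for k x y
  proof -
    have "\<exists>y. y \<in> carrier (chains C (k + 1)) \<and> bdry C (k + 1) y = A k x" using y by blast
    from someI_ex[OF this] show ?thesis unfolding K_def using y by (intro P_cong) auto
  qed
  have K: "K k x \<in> carrier (chains C (k + 1))" "P (k + 1) (K k x) = K k x"
    "bdry C (k + 1) (K k x) = A k x" "level C (k + 1) (K k x) \<le> level C k x + \<epsilon>"
    if x: "x \<in> carrier (chains C k)" for k x
  proof -
    obtain y where y: "y \<in> carrier (chains C (k + 1))" "level C (k + 1) y \<le> level C k x + \<epsilon>"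
      "bdry C (k + 1) y = A k x" using ex[OF x] by blast
    note eq = K_eq[OF x y(1,3)]
    show "K k x \<in> carrier (chains C (k + 1))" "P (k + 1) (K k x) = K k x"
      "bdry C (k + 1) (K k x) = A k x"
      unfolding eq using y by simp_all
    show "level C (k + 1) (K k x) \<le> level C k x + \<epsilon>"
      unfolding eq using level_P[OF y(1)] y(2) by (rule order_trans)
  qed
  show thesis
  proof (rule that[of K])
    fix k
    have "K k (x \<oplus>\<^bsub>chains C k\<^esub> y) = K k x \<oplus>\<^bsub>chains C (k + 1)\<^esub> K k y"
      if "x \<in> carrier (chains C k)" "y \<in> carrier (chains C k)" for x y
    proof -
      \<comment> \<open>The sum of \<open>K k x\<close> and \<open>K k y\<close> has the boundary
        required for the sum of x and y, and \<open>P\<close> fixes it.\<close>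
      have "K k (x \<oplus>\<^bsub>chains C k\<^esub> y) = P (k + 1) (K k x \<oplus>\<^bsub>chains C (k + 1)\<^esub> K k y)"
        using that K LinearCombinations.module_hom_add[OF A_hom]
          LinearCombinations.module_hom_add[OF b_hom]
        by (intro K_eq) simp_all
      then show ?thesis using that K by simp
    qed
    moreover have "K k (a \<odot>\<^bsub>chains C k\<^esub> x) = a \<odot>\<^bsub>chains C (k + 1)\<^esub> K k x"
      if "a \<in> carrier (novikov \<Gamma>)" "x \<in> carrier (chains C k)" for a x
    proof -
      have "K k (a \<odot>\<^bsub>chains C k\<^esub> x) = P (k + 1) (a \<odot>\<^bsub>chains C (k + 1)\<^esub> K k x)"
        using that K LinearCombinations.module_hom_smult[OF A_hom]
          LinearCombinations.module_hom_smult[OF b_hom]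
        by (intro K_eq) simp_all
      then show ?thesis using that K by simp
    qed
    ultimately show "K k \<in> LinearCombinations.module_hom (novikov \<Gamma>) (chains C k) (chains C (k + 1))"
      using K(1) unfolding LinearCombinations.module_hom_def by auto
    fix x assume x: "x \<in> carrier (chains C k)"
    show "level C (k + 1) (K k x) \<le> level C k x + \<epsilon>" using K(4)[OF x] .
    let ?w = "M k x \<ominus>\<^bsub>chains C k\<^esub> x"
    have w: "?w \<in> carrier (chains C k)" using x by simp
    \<comment> \<open>The boundary of x is its own cycle component, so \<open>A\<close> sends it to
      the boundary of \<open>?w\<close>. Thus \<open>?w\<close> itself can be used in
      \<open>K_eq\<close>, which gives \<open>P k ?w\<close>; commutation of \<open>P\<close> with
      \<open>M\<close> evaluates this further.\<close>
    have "A (k - 1) (bdry C k x) = bdry C k ?w"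
      using x d.f_im[OF x] by (simp add: A_def M_bdry)
    then have "K (k - 1) (bdry C k x) = P k ?w"
      using K_eq[of "bdry C k x" "k - 1" ?w] d.f_im[OF x] w by simp
    also have "\<dots> = M k (P k x) \<ominus>\<^bsub>chains C k\<^esub> P k x" using x comm by (simp add: P.f_minus)
    finally have Kd: "K (k - 1) (bdry C k x) = M k (P k x) \<ominus>\<^bsub>chains C k\<^esub> P k x" .
    let ?p = "M k (P k x) \<ominus>\<^bsub>chains C k\<^esub> P k x"
    have p: "?p \<in> carrier (chains C k)" using x by simp
    \<comment> \<open>The two terms of the homotopy formula are \<open>M\<close> minus the identity
      on the cycle component of x and on \<open>P k x\<close>; together they give its value on
      x.\<close>
    have "A k x = (M k x \<ominus>\<^bsub>chains C k\<^esub> M k (P k x)) \<ominus>\<^bsub>chains C k\<^esub> (x \<ominus>\<^bsub>chains C k\<^esub> P k x)"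
      unfolding A_def using x by simp
    also have "\<dots> = ?w \<ominus>\<^bsub>chains C k\<^esub> ?p"
      using x by (simp add: a_minus_def chain.M.minus_add chain.M.add.m_ac)
    finally have "A k x \<oplus>\<^bsub>chains C k\<^esub> ?p = ?w"
      using w p by (simp only: a_minus_def chain.M.add.m_assoc chain.M.a_inv_closed chain.M.l_neg chain.M.r_zero)
    then show "?w = bdry C (k + 1) (K k x) \<oplus>\<^bsub>chains C k\<^esub> K (k - 1) (bdry C k x)"
      unfolding K(3)[OF x] Kd ..
  qed
qed

end

section \<open>From interleavings to quasiequivalences\<close>

lemma homology_class:
  assumes "z \<in> cycles C k s"
  shows "boundaries C k s +>\<^bsub>chains C k\<^esub> z \<in> carrier (homology C k s)"
  using assms
  by (auto simp: homology_def A_FactGroup_def FactGroup_def RCOSETS_def a_r_coset_def r_coset_def)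

text \<open>As \<open>homology_map\<close> is a union over all representatives of a class, equality
  only shows that \<open>f z\<close> differs by the boundary of some y from another representative
  of the class of z, which is z plus the boundary of some u of level at most s. The chain y + u
  repairs this, and its level stays below t because s is at most t.\<close>

lemma (in floer_complex) boundary_if_homology_map_eq:
  assumes eq: "\<And>X. X \<in> carrier (homology C k s) \<Longrightarrow> homology_map C k t f X = homology_map C k t id X"
    and st: "s \<le> t" and z: "z \<in> cycles C k s" and fz: "f z \<in> carrier (chains C k)"
  obtains y where "y \<in> carrier (chains C (k + 1))" "level C (k + 1) y \<le> ereal t"
    and "bdry C (k + 1) y = f z \<ominus>\<^bsub>chains C k\<^esub> z"
proof -
  interpret b: mod_hom "novikov \<Gamma>" "chains C (k + 1)" "chains C k" "bdry C (k + 1)"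
    using d.mod_hom_axioms[of "k + 1"] by simp
  have zC: "z \<in> carrier (chains C k)" using z unfolding cycles_def sublevel_def by blast
  have coset: "x \<in> boundaries C k r +>\<^bsub>chains C k\<^esub> w \<longleftrightarrow>
      (\<exists>y\<in>sublevel C (k + 1) r. x = bdry C (k + 1) y \<oplus>\<^bsub>chains C k\<^esub> w)" for x w r
    by (auto simp: a_r_coset_def r_coset_def boundaries_def)
  have mem: "w \<in> boundaries C k r +>\<^bsub>chains C k\<^esub> w" if "w \<in> carrier (chains C k)" for w r
    unfolding coset using that by (intro bexI[of _ "\<zero>\<^bsub>chains C (k + 1)\<^esub>"]) (auto simp: sublevel_def)
  let ?X = "boundaries C k s +>\<^bsub>chains C k\<^esub> z"
  have "f z \<in> homology_map C k t f ?X"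
    unfolding homology_map_def using mem[OF zC] mem[OF fz] by blast
  then have "f z \<in> homology_map C k t id ?X" using eq homology_class[OF z] by blast
  then obtain y u where y: "y \<in> sublevel C (k + 1) t" and u: "u \<in> sublevel C (k + 1) s"
    and f_eq: "f z = bdry C (k + 1) y \<oplus>\<^bsub>chains C k\<^esub> (bdry C (k + 1) u \<oplus>\<^bsub>chains C k\<^esub> z)"
    unfolding homology_map_def by (auto simp: coset)
  have yu: "y \<in> carrier (chains C (k + 1))" "u \<in> carrier (chains C (k + 1))"
    "level C (k + 1) y \<le> ereal t" "level C (k + 1) u \<le> ereal t"
    using y u st unfolding sublevel_def by (auto intro: order_trans)
  show thesis
  proof (rule that[of "y \<oplus>\<^bsub>chains C (k + 1)\<^esub> u"])
    show "y \<oplus>\<^bsub>chains C (k + 1)\<^esub> u \<in> carrier (chains C (k + 1))" using yu by simp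
    show "level C (k + 1) (y \<oplus>\<^bsub>chains C (k + 1)\<^esub> u) \<le> ereal t"
      using chain.level_add[OF yu(1,2)] yu(3,4) by (meson max.boundedI order_trans)
    show "bdry C (k + 1) (y \<oplus>\<^bsub>chains C (k + 1)\<^esub> u) = f z \<ominus>\<^bsub>chains C k\<^esub> z"
      unfolding f_eq using yu zC by (simp add: a_minus_def chain.M.add.m_assoc chain.M.r_neg)
  qed
qed

text \<open>Choosing the filtration value s to be the level of z turns the uniform bound s +
  \<epsilon> into one relative to z. The zero cycle has level -infinity, which is no filtration
  value, and is bounded by the zero chain.\<close>

lemma (in floer_complex) boundary_of_homology_map_eq_inclusion:
  assumes eq: "\<And>s X. X \<in> carrier (homology C k s) \<Longrightarrow>
      homology_map C k (s + \<epsilon>) f X = homology_map C k (s + \<epsilon>) id X"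
    and f: "f \<in> LinearCombinations.module_hom (novikov \<Gamma>) (chains C k) (chains C k)"
    and "\<epsilon> \<ge> 0" and z: "z \<in> carrier (chains C k)" "bdry C k z = \<zero>\<^bsub>chains C (k - 1)\<^esub>"
  shows "\<exists>y\<in>carrier (chains C (k + 1)). level C (k + 1) y \<le> level C k z + ereal \<epsilon> \<and>
    bdry C (k + 1) y = f z \<ominus>\<^bsub>chains C k\<^esub> z"
proof -
  interpret b: mod_hom "novikov \<Gamma>" "chains C (k + 1)" "chains C k" "bdry C (k + 1)"
    using d.mod_hom_axioms[of "k + 1"] by simp
  interpret f: mod_hom "novikov \<Gamma>" "chains C k" "chains C k" f
    by unfold_locales (rule f)
  consider "z = \<zero>\<^bsub>chains C k\<^esub>" | s where "level C k z = ereal s"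
    using chain.level_not_PInf[OF z(1)] chain.level_eq_MInf_iff[OF z(1)] by (cases "level C k z") auto
  then show ?thesis
  proof cases
    case 1
    then show ?thesis by (intro bexI[of _ "\<zero>\<^bsub>chains C (k + 1)\<^esub>"]) auto
  next
    case (2 s)
    then have "z \<in> cycles C k s" using z unfolding cycles_def sublevel_def by simp
    from boundary_if_homology_map_eq[OF eq _ this f.f_im[OF z(1)]] \<open>\<epsilon> \<ge> 0\<close> 2 show ?thesis
      by (metis le_add_same_cancel1 plus_ereal.simps(1))
  qed
qed

text \<open>\<open>\<Phi>'\<close> is \<open>\<Phi>\<close> without its component from the complement of the cycles to the cycles.\<close>

lemma block_diagonal_chain_map:
  assumes "split_floer_complex \<Gamma> C P" and "split_floer_complex \<Gamma> D Q"
    and \<Phi>: "chain_map \<Gamma> C D \<Phi>"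
    and lev: "\<And>k x. x \<in> carrier (chains C k) \<Longrightarrow> level D k (\<Phi> k x) \<le> level C k x + \<delta>"
  obtains \<Phi>' where "chain_map \<Gamma> C D \<Phi>'"
    and "\<And>k x. x \<in> carrier (chains C k) \<Longrightarrow> level D k (\<Phi>' k x) \<le> level C k x + \<delta>"
    and "\<And>k x. x \<in> carrier (chains C k) \<Longrightarrow> Q k (\<Phi>' k x) = \<Phi>' k (P k x)"
    and "\<And>k x. x \<in> carrier (chains C k) \<Longrightarrow> bdry C k x = \<zero>\<^bsub>chains C (k - 1)\<^esub> \<Longrightarrow> \<Phi>' k x = \<Phi> k x"
proof -
  interpret C: split_floer_complex \<Gamma> C P by fact
  interpret D: split_floer_complex \<Gamma> D Q by fact
  interpret \<Phi>: mod_hom "novikov \<Gamma>" "chains C k" "chains D k" "\<Phi> k" for k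
    by unfold_locales (use \<Phi> in \<open>auto simp: chain_map_def\<close>)
  have \<Phi>_bdry: "\<Phi> (k - 1) (bdry C k x) = bdry D k (\<Phi> k x)" if "x \<in> carrier (chains C k)" for k x
    using \<Phi> that unfolding chain_map_def by blast
  let ?z = "\<lambda>k x. x \<ominus>\<^bsub>chains C k\<^esub> P k x"
  \<comment> \<open>\<open>Q\<close> discards the cycle component of the image of
    \<open>P k x\<close>. The cycle component of x is mapped by \<Phi> as before, and its image is
    again a cycle.\<close>
  define \<Phi>' where "\<Phi>' k x = Q k (\<Phi> k (P k x)) \<oplus>\<^bsub>chains D k\<^esub> \<Phi> k (?z k x)" for k x
  have on_cycles: "\<Phi>' k x = \<Phi> k x"
    if "x \<in> carrier (chains C k)" "bdry C k x = \<zero>\<^bsub>chains C (k - 1)\<^esub>" for k x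
    unfolding \<Phi>'_def using that C.P_cycle[OF that] by simp
  show thesis
  proof (rule that[of \<Phi>'])
    have "\<Phi>' k \<in> LinearCombinations.module_hom (novikov \<Gamma>) (chains C k) (chains D k)" for k
    proof -
      have "(\<lambda>x. x) \<in> LinearCombinations.module_hom (novikov \<Gamma>) (chains C k) (chains C k)"
        by (simp add: LinearCombinations.module_hom_def)
      then have "?z k \<in> LinearCombinations.module_hom (novikov \<Gamma>) (chains C k) (chains C k)"
        using C.P.f_hom by (rule module_hom_diff[OF C.chain.module_axioms])
      from module_hom_comp[OF this \<Phi>.f_hom]
        module_hom_comp[OF module_hom_comp[OF C.P.f_hom \<Phi>.f_hom] D.P.f_hom]
      show ?thesis unfolding \<Phi>'_def by (intro module_hom_sum[OF D.chain.module_axioms])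
    qed
    moreover have "\<Phi>' (k - 1) (bdry C k x) = bdry D k (\<Phi>' k x)" if x: "x \<in> carrier (chains C k)" for k x
    proof -
      \<comment> \<open>A boundary is a cycle, and there \<open>\<Phi>'\<close> agrees with \<Phi>.
        On the other side \<open>Q\<close> leaves the boundary of a chain unchanged.\<close>
      have "\<Phi>' (k - 1) (bdry C k x) = \<Phi> (k - 1) (bdry C k x)"
        using x by (intro on_cycles) (simp_all add: diff_diff_eq)
      also have "\<dots> = bdry D k (\<Phi> k (P k x)) \<oplus>\<^bsub>chains D (k - 1)\<^esub> bdry D k (\<Phi> k (?z k x))"
        using x by (simp add: \<Phi>_bdry[symmetric] C.bdry_minus_P)
      also have "\<dots> = bdry D k (\<Phi>' k x)" unfolding \<Phi>'_def using x by simp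
      finally show ?thesis .
    qed
    ultimately show "chain_map \<Gamma> C D \<Phi>'" unfolding chain_map_def by blast
    fix k x assume x: "x \<in> carrier (chains C k)"
    show "\<Phi>' k x = \<Phi> k x" if "bdry C k x = \<zero>\<^bsub>chains C (k - 1)\<^esub>" using on_cycles[OF x that] .
    have "level D k (Q k (\<Phi> k (P k x))) \<le> level D k (\<Phi> k (P k x))" using x by (intro D.level_P) simp
    also have "\<dots> \<le> level C k (P k x) + \<delta>" using x by (intro lev) simp
    also have "\<dots> \<le> level C k x + \<delta>" using C.level_P[OF x] by (rule add_right_mono)
    finally have 1: "level D k (Q k (\<Phi> k (P k x))) \<le> level C k x + \<delta>" .
    have "level D k (\<Phi> k (?z k x)) \<le> level C k (?z k x) + \<delta>" using x by (intro lev) simp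
    also have "\<dots> \<le> level C k x + \<delta>" using C.level_minus_P[OF x] by (rule add_right_mono)
    finally have 2: "level D k (\<Phi> k (?z k x)) \<le> level C k x + \<delta>" .
    have "level D k (\<Phi>' k x) \<le> max (level D k (Q k (\<Phi> k (P k x)))) (level D k (\<Phi> k (?z k x)))"
      unfolding \<Phi>'_def using x by (intro D.chain.level_add) simp_all
    then show "level D k (\<Phi>' k x) \<le> level C k x + \<delta>" using 1 2 by (meson max.boundedI order_trans)
    \<comment> \<open>The second summand of \<open>\<Phi>' k x\<close> is a cycle and disappears
      under \<open>Q\<close>. Since \<open>P\<close> is idempotent, what remains is the value of
      \<open>\<Phi>'\<close> on \<open>P k x\<close>.\<close>
    have "bdry D k (\<Phi> k (?z k x)) = \<zero>\<^bsub>chains D (k - 1)\<^esub>"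
      using x by (simp only: \<Phi>_bdry[symmetric] C.bdry_minus_P[OF x] \<Phi>.f0_is_0
          C.chain.M.minus_closed C.P.f_im)
    then have "Q k (\<Phi> k (?z k x)) = \<zero>\<^bsub>chains D k\<^esub>" using x by (intro D.P_cycle) simp_all
    then have "Q k (\<Phi>' k x) = Q k (\<Phi> k (P k x))" unfolding \<Phi>'_def using x by (simp del: \<Phi>.f_minus)
    also have "\<dots> = \<Phi>' k (P k x)" unfolding \<Phi>'_def using x by simp
    finally show "Q k (\<Phi>' k x) = \<Phi>' k (P k x)" .
  qed
qed

section \<open>Assembling the quasiequivalence\<close>

lemma chain_map_comp:
  assumes "chain_map \<Gamma> B C \<Phi>" "chain_map \<Gamma> C D \<Psi>"
  shows "chain_map \<Gamma> B D (\<lambda>k x. \<Psi> k (\<Phi> k x))"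
proof -
  have "\<Phi> k \<in> LinearCombinations.module_hom (novikov \<Gamma>) (chains B k) (chains C k)"
    "\<Psi> k \<in> LinearCombinations.module_hom (novikov \<Gamma>) (chains C k) (chains D k)" for k
    using assms unfolding chain_map_def by blast+
  then have "(\<lambda>x. \<Psi> k (\<Phi> k x)) \<in> LinearCombinations.module_hom (novikov \<Gamma>) (chains B k) (chains D k)"
    and "x \<in> carrier (chains B k) \<Longrightarrow> \<Phi> k x \<in> carrier (chains C k)" for k x
    by (auto intro: module_hom_comp dest: module_hom_closed)
  then show ?thesis using assms unfolding chain_map_def by simp
qed

theorem corollaryA3:
  fixes \<Gamma> :: "real set" and \<delta> :: real
    and C :: "('k::field, 'c) filtered_complex" and D :: "('k, 'd) filtered_complex"
  assumes "real_subgroup \<Gamma>" and "\<delta> \<ge> 0"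
    and "floer_type_complex \<Gamma> C" and "floer_type_complex \<Gamma> D"
    and "\<exists>\<Phi> \<Psi>. chain_interleaving \<Gamma> \<delta> C D \<Phi> \<Psi>"
  shows "\<exists>\<Phi> \<Psi> K\<^sub>C K\<^sub>D. quasiequivalence \<Gamma> \<delta> C D \<Phi> \<Psi> K\<^sub>C K\<^sub>D"
proof -
  interpret C: floer_complex \<Gamma> C by unfold_locales fact
  interpret D: floer_complex \<Gamma> D by unfold_locales fact
  obtain P where "C.splitting P" using C.splitting_exists by blast
  then interpret C: split_floer_complex \<Gamma> C P by unfold_locales
  obtain Q where "D.splitting Q" using D.splitting_exists by blast
  then interpret D: split_floer_complex \<Gamma> D Q by unfold_locales
  obtain \<Phi> \<Psi> where int: "chain_interleaving \<Gamma> \<delta> C D \<Phi> \<Psi>" using assms(5) by blast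
  then have \<Phi>: "chain_map \<Gamma> C D \<Phi>" and \<Psi>: "chain_map \<Gamma> D C \<Psi>"
    and lev: "\<And>k c. c \<in> carrier (chains C k) \<Longrightarrow> level D k (\<Phi> k c) \<le> level C k c + ereal \<delta>"
      "\<And>k d. d \<in> carrier (chains D k) \<Longrightarrow> level C k (\<Psi> k d) \<le> level D k d + ereal \<delta>"
    and hom: "\<And>k s X. X \<in> carrier (homology C k s) \<Longrightarrow>
        homology_map C k (s + 2 * \<delta>) (\<lambda>x. \<Psi> k (\<Phi> k x)) X = homology_map C k (s + 2 * \<delta>) id X"
      "\<And>k s X. X \<in> carrier (homology D k s) \<Longrightarrow>
        homology_map D k (s + 2 * \<delta>) (\<lambda>x. \<Phi> k (\<Psi> k x)) X = homology_map D k (s + 2 * \<delta>) id X"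
    unfolding chain_interleaving_def comp_def by blast+
  obtain \<Phi>' where \<Phi>': "chain_map \<Gamma> C D \<Phi>'"
    and \<Phi>'_lev: "\<And>k x. x \<in> carrier (chains C k) \<Longrightarrow> level D k (\<Phi>' k x) \<le> level C k x + ereal \<delta>"
    and \<Phi>'_comm: "\<And>k x. x \<in> carrier (chains C k) \<Longrightarrow> Q k (\<Phi>' k x) = \<Phi>' k (P k x)"
    and \<Phi>'_cycle: "\<And>k x. x \<in> carrier (chains C k) \<Longrightarrow> bdry C k x = \<zero>\<^bsub>chains C (k - 1)\<^esub> \<Longrightarrow>
      \<Phi>' k x = \<Phi> k x"
    using block_diagonal_chain_map[OF C.split_floer_complex_axioms D.split_floer_complex_axioms \<Phi> lev(1)]
    by blast
  obtain \<Psi>' where \<Psi>': "chain_map \<Gamma> D C \<Psi>'"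
    and \<Psi>'_lev: "\<And>k x. x \<in> carrier (chains D k) \<Longrightarrow> level C k (\<Psi>' k x) \<le> level D k x + ereal \<delta>"
    and \<Psi>'_comm: "\<And>k x. x \<in> carrier (chains D k) \<Longrightarrow> P k (\<Psi>' k x) = \<Psi>' k (Q k x)"
    and \<Psi>'_cycle: "\<And>k x. x \<in> carrier (chains D k) \<Longrightarrow> bdry D k x = \<zero>\<^bsub>chains D (k - 1)\<^esub> \<Longrightarrow>
      \<Psi>' k x = \<Psi> k x"
    using block_diagonal_chain_map[OF D.split_floer_complex_axioms C.split_floer_complex_axioms \<Psi> lev(2)]
    by blast
  have closed: "\<Phi>' k x \<in> carrier (chains D k)" "\<Phi> k x \<in> carrier (chains D k)"
    if "x \<in> carrier (chains C k)" for k x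
    using \<Phi> \<Phi>' that unfolding chain_map_def by (auto dest!: module_hom_closed spec[of _ k])
  have closed': "\<Psi>' k x \<in> carrier (chains C k)" "\<Psi> k x \<in> carrier (chains C k)"
    if "x \<in> carrier (chains D k)" for k x
    using \<Psi> \<Psi>' that unfolding chain_map_def by (auto dest!: module_hom_closed spec[of _ k])
  have cycle: "bdry D k (\<Phi> k x) = \<zero>\<^bsub>chains D (k - 1)\<^esub>"
    if "x \<in> carrier (chains C k)" "bdry C k x = \<zero>\<^bsub>chains C (k - 1)\<^esub>" for k x
  proof -
    interpret mod_hom "novikov \<Gamma>" "chains C (k - 1)" "chains D (k - 1)" "\<Phi> (k - 1)"
      by unfold_locales (use \<Phi> in \<open>simp add: chain_map_def\<close>)
    show ?thesis using \<Phi> that f0_is_0 unfolding chain_map_def by metis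
  qed
  have cycle': "bdry C k (\<Psi> k x) = \<zero>\<^bsub>chains C (k - 1)\<^esub>"
    if "x \<in> carrier (chains D k)" "bdry D k x = \<zero>\<^bsub>chains D (k - 1)\<^esub>" for k x
  proof -
    interpret mod_hom "novikov \<Gamma>" "chains D (k - 1)" "chains C (k - 1)" "\<Psi> (k - 1)"
      by unfold_locales (use \<Psi> in \<open>simp add: chain_map_def\<close>)
    show ?thesis using \<Psi> that f0_is_0 unfolding chain_map_def by metis
  qed
  have \<epsilon>: "2 * \<delta> \<ge> 0" using \<open>\<delta> \<ge> 0\<close> by simp
  have M: "chain_map \<Gamma> C C (\<lambda>k x. \<Psi> k (\<Phi> k x))" "chain_map \<Gamma> D D (\<lambda>k x. \<Phi> k (\<Psi> k x))"
    using \<Phi> \<Psi> by (auto intro: chain_map_comp)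
  \<comment> \<open>On a cycle z the modified maps agree with the given ones, also at the second
    stage because \<open>\<Phi> k z\<close> is a cycle. So the homology condition on \<Phi> and
    \<Psi> carries over to \<open>\<Phi>'\<close> and \<open>\<Psi>'\<close>.\<close>
  have bound_C: "\<exists>y\<in>carrier (chains C (k + 1)). level C (k + 1) y \<le> level C k z + ereal (2 * \<delta>) \<and>
      bdry C (k + 1) y = \<Psi>' k (\<Phi>' k z) \<ominus>\<^bsub>chains C k\<^esub> z"
    if "z \<in> carrier (chains C k)" "bdry C k z = \<zero>\<^bsub>chains C (k - 1)\<^esub>" for k z
    using C.boundary_of_homology_map_eq_inclusion[OF hom(1) _ \<epsilon> that] M(1) that cycle closed
    by (simp add: \<Phi>'_cycle \<Psi>'_cycle chain_map_def)
  \<comment> \<open>This commutation is the reason for passing to \<open>\<Phi>'\<close> and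
    \<open>\<Psi>'\<close>: \<open>homotopy_exists\<close> needs it to identify \<open>K\<close> on
    boundaries.\<close>
  have comm_C: "P k (\<Psi>' k (\<Phi>' k x)) = \<Psi>' k (\<Phi>' k (P k x))" if "x \<in> carrier (chains C k)" for k x
    using that closed by (simp add: \<Phi>'_comm \<Psi>'_comm)
  obtain K\<^sub>C where K\<^sub>C:
    "\<And>k. K\<^sub>C k \<in> LinearCombinations.module_hom (novikov \<Gamma>) (chains C k) (chains C (k + 1))"
    "\<And>k x. x \<in> carrier (chains C k) \<Longrightarrow> \<Psi>' k (\<Phi>' k x) \<ominus>\<^bsub>chains C k\<^esub> x =
      bdry C (k + 1) (K\<^sub>C k x) \<oplus>\<^bsub>chains C k\<^esub> K\<^sub>C (k - 1) (bdry C k x)"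
    "\<And>k x. x \<in> carrier (chains C k) \<Longrightarrow> level C (k + 1) (K\<^sub>C k x) \<le> level C k x + ereal (2 * \<delta>)"
    by (rule C.homotopy_exists[OF chain_map_comp[OF \<Phi>' \<Psi>'] comm_C bound_C]) blast+
  have bound_D: "\<exists>y\<in>carrier (chains D (k + 1)). level D (k + 1) y \<le> level D k z + ereal (2 * \<delta>) \<and>
      bdry D (k + 1) y = \<Phi>' k (\<Psi>' k z) \<ominus>\<^bsub>chains D k\<^esub> z"
    if "z \<in> carrier (chains D k)" "bdry D k z = \<zero>\<^bsub>chains D (k - 1)\<^esub>" for k z
    using D.boundary_of_homology_map_eq_inclusion[OF hom(2) _ \<epsilon> that] M(2) that cycle' closed'
    by (simp add: \<Phi>'_cycle \<Psi>'_cycle chain_map_def)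
  have comm_D: "Q k (\<Phi>' k (\<Psi>' k x)) = \<Phi>' k (\<Psi>' k (Q k x))" if "x \<in> carrier (chains D k)" for k x
    using that closed' by (simp add: \<Phi>'_comm \<Psi>'_comm)
  obtain K\<^sub>D where K\<^sub>D:
    "\<And>k. K\<^sub>D k \<in> LinearCombinations.module_hom (novikov \<Gamma>) (chains D k) (chains D (k + 1))"
    "\<And>k x. x \<in> carrier (chains D k) \<Longrightarrow> \<Phi>' k (\<Psi>' k x) \<ominus>\<^bsub>chains D k\<^esub> x =
      bdry D (k + 1) (K\<^sub>D k x) \<oplus>\<^bsub>chains D k\<^esub> K\<^sub>D (k - 1) (bdry D k x)"
    "\<And>k x. x \<in> carrier (chains D k) \<Longrightarrow> level D (k + 1) (K\<^sub>D k x) \<le> level D k x + ereal (2 * \<delta>)"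
    by (rule D.homotopy_exists[OF chain_map_comp[OF \<Psi>' \<Phi>'] comm_D bound_D]) blast+
  \<comment> \<open>The quasiequivalence consists of the modified maps, not of the interleaving maps
    that were given.\<close>
  have "quasiequivalence \<Gamma> \<delta> C D \<Phi>' \<Psi>' K\<^sub>C K\<^sub>D"
    unfolding quasiequivalence_def by (intro conjI allI ballI \<Phi>' \<Psi>' K\<^sub>C K\<^sub>D \<Phi>'_lev \<Psi>'_lev)
  then show ?thesis by blast
qed

end
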